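(* Let $A$ be a closed symmetric operator in a complex Hilbert space $H$ (its domain need not be dense) which is invertible (injective), and suppose that $A$ has finite defect numbers, i.e. $\dim\mathcal{N}_z(A)<\infty$ for $z\in\mathbb{C}_+$ and for $z\in\mathbb{C}_-$. Then there exist a Hilbert space $\widetilde H\supseteq H$ (containing $H$ as a closed subspace) and an invertible (injective) self-adjoint operator $\widetilde A$ in $\widetilde H$ with $\widetilde A\supseteq A$.
   Context: For $z\in\mathbb{C}\setminus\mathbb{R}$, $\mathcal{N}_z(A)=H\ominus (A-zE_H)D(A)$ is the defect subspace; its dimension is constant on each of the half-planes $\mathbb{C}_+$ and $\mathbb{C}_-$ (these are the defect numbers). *)

theory Defs
  imports "HOL-Analysis.Analysis"
begin

text \<open>A complex inner-product space given explicitly by its carrier and operations.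
  The inner product is linear in the first argument, conjugate-linear in the second.\<close>

record 'a cspace =
  hcarrier :: "'a set"
  hzero :: 'a
  hadd :: "'a \<Rightarrow> 'a \<Rightarrow> 'a"
  hsmul :: "complex \<Rightarrow> 'a \<Rightarrow> 'a"
  hip :: "'a \<Rightarrow> 'a \<Rightarrow> complex"

definition hsub :: "'a cspace \<Rightarrow> 'a \<Rightarrow> 'a \<Rightarrow> 'a" where
  "hsub H x y = hadd H x (hsmul H (-1) y)"

definition hnorm :: "'a cspace \<Rightarrow> 'a \<Rightarrow> real" where
  "hnorm H x = sqrt (Re (hip H x x))"

definition hconverges :: "'a cspace \<Rightarrow> (nat \<Rightarrow> 'a) \<Rightarrow> 'a \<Rightarrow> bool" where
  "hconverges H s l \<longleftrightarrow> (\<forall>e>0. \<exists>N. \<forall>n\<ge>N. hnorm H (hsub H (s n) l) < e)"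

definition hcauchy :: "'a cspace \<Rightarrow> (nat \<Rightarrow> 'a) \<Rightarrow> bool" where
  "hcauchy H s \<longleftrightarrow> (\<forall>e>0. \<exists>N. \<forall>m\<ge>N. \<forall>n\<ge>N. hnorm H (hsub H (s m) (s n)) < e)"

definition hilbert_space :: "'a cspace \<Rightarrow> bool" where
  "hilbert_space H \<longleftrightarrow>
    hzero H \<in> hcarrier H \<and>
    (\<forall>x\<in>hcarrier H. \<forall>y\<in>hcarrier H. hadd H x y \<in> hcarrier H) \<and>
    (\<forall>a. \<forall>x\<in>hcarrier H. hsmul H a x \<in> hcarrier H) \<and>
    (\<forall>x\<in>hcarrier H. \<forall>y\<in>hcarrier H. \<forall>z\<in>hcarrier H.
        hadd H (hadd H x y) z = hadd H x (hadd H y z)) \<and>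
    (\<forall>x\<in>hcarrier H. \<forall>y\<in>hcarrier H. hadd H x y = hadd H y x) \<and>
    (\<forall>x\<in>hcarrier H. hadd H (hzero H) x = x) \<and>
    (\<forall>x\<in>hcarrier H. \<exists>y\<in>hcarrier H. hadd H x y = hzero H) \<and>
    (\<forall>a. \<forall>x\<in>hcarrier H. \<forall>y\<in>hcarrier H.
        hsmul H a (hadd H x y) = hadd H (hsmul H a x) (hsmul H a y)) \<and>
    (\<forall>a b. \<forall>x\<in>hcarrier H. hsmul H (a + b) x = hadd H (hsmul H a x) (hsmul H b x)) \<and>
    (\<forall>a b. \<forall>x\<in>hcarrier H. hsmul H (a * b) x = hsmul H a (hsmul H b x)) \<and>
    (\<forall>x\<in>hcarrier H. hsmul H 1 x = x) \<and>
    (\<forall>x\<in>hcarrier H. \<forall>y\<in>hcarrier H. \<forall>z\<in>hcarrier H.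
        hip H (hadd H x y) z = hip H x z + hip H y z) \<and>
    (\<forall>a. \<forall>x\<in>hcarrier H. \<forall>y\<in>hcarrier H. hip H (hsmul H a x) y = a * hip H x y) \<and>
    (\<forall>x\<in>hcarrier H. \<forall>y\<in>hcarrier H. hip H y x = cnj (hip H x y)) \<and>
    (\<forall>x\<in>hcarrier H. Re (hip H x x) \<ge> 0) \<and>
    (\<forall>x\<in>hcarrier H. hip H x x = 0 \<longrightarrow> x = hzero H) \<and>
    (\<forall>s. (\<forall>n. s n \<in> hcarrier H) \<and> hcauchy H s \<longrightarrow>
        (\<exists>l\<in>hcarrier H. hconverges H s l))"

definition hclosed_set :: "'a cspace \<Rightarrow> 'a set \<Rightarrow> bool" where
  "hclosed_set H S \<longleftrightarrow>
     (\<forall>s l. (\<forall>n. s n \<in> S) \<and> l \<in> hcarrier H \<and> hconverges H s l \<longrightarrow> l \<in> S)"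

definition hdense :: "'a cspace \<Rightarrow> 'a set \<Rightarrow> bool" where
  "hdense H S \<longleftrightarrow> (\<forall>x\<in>hcarrier H. \<forall>e>0. \<exists>d\<in>S. hnorm H (hsub H x d) < e)"

definition hlincomb :: "'a cspace \<Rightarrow> complex list \<Rightarrow> 'a list \<Rightarrow> 'a" where
  "hlincomb H cs fs = foldr (\<lambda>(c, g) acc. hadd H (hsmul H c g) acc) (zip cs fs) (hzero H)"

definition hfinite_dim :: "'a cspace \<Rightarrow> 'a set \<Rightarrow> bool" where
  "hfinite_dim H S \<longleftrightarrow> (\<exists>fs. set fs \<subseteq> S \<and>
       (\<forall>v\<in>S. \<exists>cs. length cs = length fs \<and> v = hlincomb H cs fs))"

definition linear_operator :: "'a cspace \<Rightarrow> 'a set \<Rightarrow> ('a \<Rightarrow> 'a) \<Rightarrow> bool" where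
  "linear_operator H D T \<longleftrightarrow>
     D \<subseteq> hcarrier H \<and> hzero H \<in> D \<and>
     (\<forall>x\<in>D. \<forall>y\<in>D. hadd H x y \<in> D) \<and> (\<forall>a. \<forall>x\<in>D. hsmul H a x \<in> D) \<and>
     (\<forall>x\<in>D. T x \<in> hcarrier H) \<and>
     (\<forall>x\<in>D. \<forall>y\<in>D. T (hadd H x y) = hadd H (T x) (T y)) \<and>
     (\<forall>a. \<forall>x\<in>D. T (hsmul H a x) = hsmul H a (T x))"

definition closed_operator :: "'a cspace \<Rightarrow> 'a set \<Rightarrow> ('a \<Rightarrow> 'a) \<Rightarrow> bool" where
  "closed_operator H D T \<longleftrightarrow> linear_operator H D T \<and>
     (\<forall>s x y. (\<forall>n. s n \<in> D) \<and> x \<in> hcarrier H \<and> y \<in> hcarrier H \<and>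
        hconverges H s x \<and> hconverges H (\<lambda>n. T (s n)) y \<longrightarrow> x \<in> D \<and> T x = y)"

definition symmetric_operator :: "'a cspace \<Rightarrow> 'a set \<Rightarrow> ('a \<Rightarrow> 'a) \<Rightarrow> bool" where
  "symmetric_operator H D T \<longleftrightarrow> linear_operator H D T \<and>
     (\<forall>x\<in>D. \<forall>y\<in>D. hip H (T x) y = hip H x (T y))"

definition op_graph :: "'a set \<Rightarrow> ('a \<Rightarrow> 'a) \<Rightarrow> ('a \<times> 'a) set" where
  "op_graph D T = {(x, T x) | x. x \<in> D}"

text \<open>Graph of the adjoint (a linear relation in general).\<close>
definition adjoint_graph :: "'a cspace \<Rightarrow> 'a set \<Rightarrow> ('a \<Rightarrow> 'a) \<Rightarrow> ('a \<times> 'a) set" where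
  "adjoint_graph H D T = {(y, w). y \<in> hcarrier H \<and> w \<in> hcarrier H \<and>
       (\<forall>x\<in>D. hip H (T x) y = hip H x w)}"

definition self_adjoint :: "'a cspace \<Rightarrow> 'a set \<Rightarrow> ('a \<Rightarrow> 'a) \<Rightarrow> bool" where
  "self_adjoint H D T \<longleftrightarrow> linear_operator H D T \<and> hdense H D \<and>
     adjoint_graph H D T = op_graph D T"

definition defect_space :: "'a cspace \<Rightarrow> 'a set \<Rightarrow> ('a \<Rightarrow> 'a) \<Rightarrow> complex \<Rightarrow> 'a set" where
  "defect_space H D T z = {u \<in> hcarrier H.
       \<forall>x\<in>D. hip H (hsub H (T x) (hsmul H z x)) u = 0}"

definition isometric_embedding :: "'a cspace \<Rightarrow> 'b cspace \<Rightarrow> ('a \<Rightarrow> 'b) \<Rightarrow> bool" where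
  "isometric_embedding H H' J \<longleftrightarrow>
     (\<forall>x\<in>hcarrier H. J x \<in> hcarrier H') \<and>
     (\<forall>x\<in>hcarrier H. \<forall>y\<in>hcarrier H. J (hadd H x y) = hadd H' (J x) (J y)) \<and>
     (\<forall>a. \<forall>x\<in>hcarrier H. J (hsmul H a x) = hsmul H' a (J x)) \<and>
     (\<forall>x\<in>hcarrier H. \<forall>y\<in>hcarrier H. hip H' (J x) (J y) = hip H x y) \<and>
     hclosed_set H' (J ` hcarrier H)"

end

theory Submission
  imports Defs
begin

text \<open>
  The Cayley transform \<open>V = (A - \<i>)(A + \<i>)\<inverse>\<close> is an isometry between the closed subspaces
  \<open>M = (A + \<i>)D\<close> and \<open>M' = (A - \<i>)D\<close>, and \<open>A\<close> is a well-defined injective operator exactly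
  because neither \<open>1\<close> nor \<open>-1\<close> is an eigenvalue of \<open>V\<close>. Extended by zero to all of \<open>H\<close>, the partial
  isometry \<open>V\<close> has a unitary dilation \<open>U\<close> of Schaeffer type on
  \<open>\<dots> \<oplus> M'\<^sup>\<bottom> \<oplus> M'\<^sup>\<bottom> \<oplus> H \<oplus> M\<^sup>\<bottom> \<oplus> M\<^sup>\<bottom> \<oplus> \<dots>\<close>,
  which shifts to the right, feeds the part of a vector of \<open>H\<close> orthogonal to \<open>M\<close> into the right
  tail, and fills the missing part \<open>M'\<^sup>\<bottom>\<close> of the range from the left tail. An eigenvector of \<open>U\<close>
  for a unimodular eigenvalue has constant norm along each tail, so square summability kills the tails
  and leaves an eigenvector of \<open>V\<close>. Hence \<open>U\<close> has no eigenvalues \<open>1\<close> and \<open>-1\<close> either, and its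
  inverse Cayley transform is an injective self-adjoint extension of \<open>A\<close>. Finiteness of the defect
  numbers only serves to encode the tails by sequences of complex numbers.
\<close>

subsection \<open>Hilbert spaces with carrier\<close>

locale hilb =
  fixes H :: "'a cspace"
  assumes hilbert: "hilbert_space H"
begin

abbreviation "C \<equiv> hcarrier H"
abbreviation "ip \<equiv> hip H"

lemma hilbert_axioms:
  "hzero H \<in> C"
  "\<forall>x\<in>C. \<forall>y\<in>C. hadd H x y \<in> C"
  "\<forall>a. \<forall>x\<in>C. hsmul H a x \<in> C"
  "\<forall>x\<in>C. \<forall>y\<in>C. \<forall>z\<in>C. hadd H (hadd H x y) z = hadd H x (hadd H y z)"
  "\<forall>x\<in>C. \<forall>y\<in>C. hadd H x y = hadd H y x"
  "\<forall>x\<in>C. hadd H (hzero H) x = x"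
  "\<forall>a b. \<forall>x\<in>C. hsmul H (a + b) x = hadd H (hsmul H a x) (hsmul H b x)"
  "\<forall>x\<in>C. hsmul H 1 x = x"
  "\<forall>x\<in>C. \<forall>y\<in>C. \<forall>z\<in>C. ip (hadd H x y) z = ip x z + ip y z"
  "\<forall>a. \<forall>x\<in>C. \<forall>y\<in>C. ip (hsmul H a x) y = a * ip x y"
  "\<forall>x\<in>C. \<forall>y\<in>C. ip y x = cnj (ip x y)"
  "\<forall>x\<in>C. Re (ip x x) \<ge> 0"
  "\<forall>x\<in>C. ip x x = 0 \<longrightarrow> x = hzero H"
  "\<forall>s. (\<forall>n. s n \<in> C) \<and> hcauchy H s \<longrightarrow> (\<exists>l\<in>C. hconverges H s l)"
  using hilbert[unfolded hilbert_space_def] by - (elim conjE, assumption)+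

lemmas zero_closed [simp] = hilbert_axioms(1)
  and add_closed [simp] = hilbert_axioms(2)[rule_format]
  and smul_closed [simp] = hilbert_axioms(3)[rule_format]
  and add_assoc = hilbert_axioms(4)[rule_format]
  and add_commute = hilbert_axioms(5)[rule_format]
  and add_zero_left = hilbert_axioms(6)[rule_format]
  and smul_add_left = hilbert_axioms(7)[rule_format]
  and smul_one = hilbert_axioms(8)[rule_format]
  and ip_add_left [simp] = hilbert_axioms(9)[rule_format]
  and ip_smul_left [simp] = hilbert_axioms(10)[rule_format]
  and ip_cnj = hilbert_axioms(11)[rule_format]
  and ip_nonneg = hilbert_axioms(12)[rule_format]
  and ip_self_eq_0D = hilbert_axioms(13)[rule_format]
  and complete = hilbert_axioms(14)[rule_format, OF conjI, rule_format]

lemma ip_add_right [simp]: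
  "x \<in> C \<Longrightarrow> y \<in> C \<Longrightarrow> z \<in> C \<Longrightarrow> ip z (hadd H x y) = ip z x + ip z y"
  by (metis add_closed complex_cnj_add ip_add_left ip_cnj)

lemma ip_smul_right [simp]: "x \<in> C \<Longrightarrow> y \<in> C \<Longrightarrow> ip y (hsmul H a x) = cnj a * ip y x"
  by (metis complex_cnj_mult ip_cnj ip_smul_left smul_closed)

lemma sub_closed [simp]: "x \<in> C \<Longrightarrow> y \<in> C \<Longrightarrow> hsub H x y \<in> C"
  by (simp add: hsub_def)

lemma ip_sub_left [simp]:
  "x \<in> C \<Longrightarrow> y \<in> C \<Longrightarrow> z \<in> C \<Longrightarrow> ip (hsub H x y) z = ip x z - ip y z"
  by (simp add: hsub_def)

lemma ip_sub_right [simp]: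
  "x \<in> C \<Longrightarrow> y \<in> C \<Longrightarrow> z \<in> C \<Longrightarrow> ip z (hsub H x y) = ip z x - ip z y"
  by (simp add: hsub_def)

lemma ip_zero_left [simp]: "x \<in> C \<Longrightarrow> ip (hzero H) x = 0"
  by (metis add_zero_left add_cancel_left_left ip_add_left zero_closed)

lemma ip_zero_right [simp]: "x \<in> C \<Longrightarrow> ip x (hzero H) = 0"
  by (metis complex_cnj_zero ip_cnj ip_zero_left zero_closed)

lemma sub_eq_zeroD:
  assumes "x \<in> C" "y \<in> C" "hsub H x y = hzero H"
  shows "x = y"
proof -
  have m: "hadd H y (hsmul H (-1) y) = hsmul H 0 y"
    using smul_add_left[of y 1 "-1"] assms smul_one by simp
  \<comment> \<open>Definiteness of the inner product shows that \<open>hsmul H 0 y\<close> is the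
    zero vector. Hence \<open>hsmul H (-1) y\<close> is the additive inverse of \<open>y\<close>,
    and cancellation becomes available.\<close>
  have "ip (hsmul H 0 y) (hsmul H 0 y) = 0" using assms by simp
  then have z: "hsmul H 0 y = hzero H" using ip_self_eq_0D assms by simp
  have "x = hadd H x (hadd H (hsmul H (-1) y) y)"
    using z m assms by (metis add_commute add_zero_left smul_closed zero_closed)
  also have "\<dots> = hadd H (hsub H x y) y"
    unfolding hsub_def using assms by (simp add: add_assoc)
  also have "\<dots> = y" using assms by (simp add: add_zero_left)
  finally show ?thesis .
qed

text \<open>Vector identities are proved by testing them against all vectors: the inner product
  turns them into identities of complex numbers.\<close>

lemma vec_eqI:
  assumes "x \<in> C" "y \<in> C" "\<And>z. z \<in> C \<Longrightarrow> ip x z = ip y z"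
  shows "x = y"
proof -
  have "ip (hsub H x y) (hsub H x y) = 0" using assms by simp
  then have "hsub H x y = hzero H" using ip_self_eq_0D[OF sub_closed] assms by blast
  then show ?thesis using sub_eq_zeroD assms by blast
qed

lemma add_zero_right: "x \<in> C \<Longrightarrow> hadd H x (hzero H) = x"
  by (rule vec_eqI) simp_all

lemma smul_zero_right: "hsmul H a (hzero H) = hzero H"
  by (rule vec_eqI) simp_all

lemma smul_zero_left: "x \<in> C \<Longrightarrow> hsmul H 0 x = hzero H"
  by (rule vec_eqI) simp_all

lemma ip_self: "x \<in> C \<Longrightarrow> ip x x = of_real ((hnorm H x)\<^sup>2)"
  by (metis Reals_cnj_iff complex_is_Real_iff hnorm_def ip_cnj ip_nonneg of_real_Re real_sqrt_pow2)

lemma norm_sq: "x \<in> C \<Longrightarrow> (hnorm H x)\<^sup>2 = Re (ip x x)"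
  by (simp add: hnorm_def ip_nonneg)

lemma norm_nonneg [simp]: "x \<in> C \<Longrightarrow> hnorm H x \<ge> 0"
  by (simp add: hnorm_def ip_nonneg)

lemma norm_eq_0D: "x \<in> C \<Longrightarrow> hnorm H x = 0 \<Longrightarrow> x = hzero H"
  by (simp add: ip_self ip_self_eq_0D)

lemma norm_zero [simp]: "hnorm H (hzero H) = 0"
  by (simp add: hnorm_def)

lemma norm_smul [simp]: "x \<in> C \<Longrightarrow> hnorm H (hsmul H a x) = cmod a * hnorm H x"
proof -
  assume x: "x \<in> C"
  have "ip (hsmul H a x) (hsmul H a x) = of_real ((cmod a)\<^sup>2) * ip x x"
    using x complex_norm_square[of a] by (simp add: mult.assoc[symmetric] mult.commute[of "cnj a"])
  then have "hnorm H (hsmul H a x) = sqrt ((cmod a)\<^sup>2 * Re (ip x x))"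
    by (simp add: hnorm_def)
  then show ?thesis by (simp add: hnorm_def real_sqrt_mult)
qed

section \<open>Cauchy-Schwarz and triangle inequalities\<close>

lemma cauchy_schwarz:
  assumes "x \<in> C" "y \<in> C"
  shows "cmod (ip x y) \<le> hnorm H x * hnorm H y"
proof (cases "hnorm H y = 0")
  case True
  then show ?thesis using norm_eq_0D assms by force
next
  case False
  \<comment> \<open>This is the component of \<open>x\<close> orthogonal to \<open>y\<close>,
    multiplied by \<open>ip y y\<close> so that no division occurs.\<close>
  define z where "z = hsub H (hsmul H (ip y y) x) (hsmul H (ip x y) y)"
  have zC: "z \<in> C" using assms by (simp add: z_def)
  have "ip z z = of_real ((hnorm H y)\<^sup>2 * ((hnorm H x * hnorm H y)\<^sup>2 - (cmod (ip x y))\<^sup>2))"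
    unfolding z_def using assms ip_cnj[of x y] complex_norm_square[of "ip x y"]
    by (simp add: ip_self[of x] ip_self[of y] algebra_simps power2_eq_square)
  then have "0 \<le> (hnorm H y)\<^sup>2 * ((hnorm H x * hnorm H y)\<^sup>2 - (cmod (ip x y))\<^sup>2)"
    using ip_nonneg[OF zC] by (metis Re_complex_of_real)
  then have "(cmod (ip x y))\<^sup>2 \<le> (hnorm H x * hnorm H y)\<^sup>2"
    using False by (simp add: zero_le_mult_iff)
  then show ?thesis using assms by (simp add: power2_le_iff_abs_le)
qed

lemma norm_triangle:
  assumes "x \<in> C" "y \<in> C"
  shows "hnorm H (hadd H x y) \<le> hnorm H x + hnorm H y"
proof -
  have "Re (ip x y) \<le> hnorm H x * hnorm H y"
    using cauchy_schwarz[OF assms] complex_Re_le_cmod order_trans by blast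
  then have "(hnorm H (hadd H x y))\<^sup>2 \<le> (hnorm H x + hnorm H y)\<^sup>2"
    using assms ip_cnj[of x y] by (simp add: norm_sq power2_sum)
  then show ?thesis using assms by (simp add: power2_le_iff_abs_le)
qed

lemma norm_sub_commute: "x \<in> C \<Longrightarrow> y \<in> C \<Longrightarrow> hnorm H (hsub H x y) = hnorm H (hsub H y x)"
  by (simp add: hnorm_def)

lemma norm_sub_triangle:
  assumes "x \<in> C" "y \<in> C" "z \<in> C"
  shows "hnorm H (hsub H x z) \<le> hnorm H (hsub H x y) + hnorm H (hsub H y z)"
proof -
  have "hsub H x z = hadd H (hsub H x y) (hsub H y z)"
    by (rule vec_eqI) (use assms in simp_all)
  then show ?thesis using norm_triangle assms by simp
qed

section \<open>Limits, and continuity of the inner product and the norm\<close>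

lemma converges_iff:
  assumes "\<And>n. s n \<in> C" "l \<in> C"
  shows "hconverges H s l \<longleftrightarrow> (\<lambda>n. hnorm H (hsub H (s n) l)) \<longlonglongrightarrow> 0"
  unfolding hconverges_def LIMSEQ_iff using assms by simp

lemma converges_unique:
  assumes "\<And>n. s n \<in> C" "l \<in> C" "l' \<in> C" "hconverges H s l" "hconverges H s l'"
  shows "l = l'"
proof -
  have "(\<lambda>n. hnorm H (hsub H (s n) l) + hnorm H (hsub H (s n) l')) \<longlonglongrightarrow> 0 + 0"
    using assms by (intro tendsto_add) (simp_all add: converges_iff)
  moreover have "hnorm H (hsub H l l') \<le> hnorm H (hsub H (s n) l) + hnorm H (hsub H (s n) l')" for n
    using norm_sub_triangle[of l "s n" l'] norm_sub_commute[of l "s n"] assms by simp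
  ultimately have "hnorm H (hsub H l l') \<le> 0"
    by (metis (no_types, lifting) LIMSEQ_le_const add_0)
  then show ?thesis using norm_eq_0D sub_eq_zeroD assms
    by (metis norm_nonneg order_antisym sub_closed)
qed

lemma ip_tendsto:
  assumes "\<And>n. s n \<in> C" "l \<in> C" "y \<in> C" "hconverges H s l"
  shows "(\<lambda>n. ip (s n) y) \<longlonglongrightarrow> ip l y"
proof -
  have lim: "(\<lambda>n. hnorm H (hsub H (s n) l) * hnorm H y) \<longlonglongrightarrow> 0"
    using tendsto_mult_left_zero converges_iff[of s l] assms by blast
  have "norm (ip (s n) y - ip l y) \<le> hnorm H (hsub H (s n) l) * hnorm H y" for n
    using cauchy_schwarz[of "hsub H (s n) l" y] assms by simp
  then have "(\<lambda>n. ip (s n) y - ip l y) \<longlonglongrightarrow> 0"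
    by (intro Lim_null_comparison[OF _ lim] always_eventually allI)
  then show ?thesis by (rule LIM_zero_cancel)
qed

lemma norm_sub_tendsto:
  assumes "\<And>n. s n \<in> C" "l \<in> C" "y \<in> C" "hconverges H s l"
  shows "(\<lambda>n. hnorm H (hsub H y (s n))) \<longlonglongrightarrow> hnorm H (hsub H y l)"
proof -
  have lim: "(\<lambda>n. hnorm H (hsub H (s n) l)) \<longlonglongrightarrow> 0"
    using converges_iff[of s l] assms by blast
  have "norm (hnorm H (hsub H y (s n)) - hnorm H (hsub H y l)) \<le> hnorm H (hsub H (s n) l)" for n
    using norm_sub_triangle[of y "s n" l] norm_sub_triangle[of y l "s n"]
      norm_sub_commute[of l "s n"] assms by simp
  then have "(\<lambda>n. hnorm H (hsub H y (s n)) - hnorm H (hsub H y l)) \<longlonglongrightarrow> 0"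
    by (intro Lim_null_comparison[OF _ lim] always_eventually allI)
  then show ?thesis by (rule LIM_zero_cancel)
qed

lemma converges_cauchy:
  assumes "\<And>n. s n \<in> C" "l \<in> C" "hconverges H s l"
  shows "hcauchy H s"
  unfolding hcauchy_def
proof (intro allI impI)
  fix e :: real assume "e > 0"
  then obtain N where N: "\<And>n. n \<ge> N \<Longrightarrow> hnorm H (hsub H (s n) l) < e / 2"
    using assms(3) unfolding hconverges_def by (meson half_gt_zero)
  have "hnorm H (hsub H (s m) (s n)) < e" if "m \<ge> N" "n \<ge> N" for m n
    using N[OF that(1)] N[OF that(2)] norm_sub_triangle[of "s m" l "s n"]
      norm_sub_commute[of l "s n"] assms by simp
  then show "\<exists>N. \<forall>m\<ge>N. \<forall>n\<ge>N. hnorm H (hsub H (s m) (s n)) < e" by blast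
qed

text \<open>Pythagoras: the vector subtracted is the projection of \<open>u\<close> onto the line
  through \<open>y\<close>. The exact gain in squared norm is what contradicts minimality of a
  distance below.\<close>

lemma norm_sq_sub_component:
  assumes "u \<in> C" "y \<in> C" "hnorm H y \<noteq> 0"
  shows "(hnorm H (hsub H u (hsmul H (ip u y / of_real ((hnorm H y)\<^sup>2)) y)))\<^sup>2
    = (hnorm H u)\<^sup>2 - (cmod (ip u y))\<^sup>2 / (hnorm H y)\<^sup>2"
proof -
  define a r c where "a = ip u y" and "r = hnorm H y" and "c = a / of_real (r\<^sup>2)"
  have sq: "a * cnj a = of_real ((cmod a)\<^sup>2)"
    using complex_norm_square[of a] by simp
  have "ip (hsub H u (hsmul H c y)) (hsub H u (hsmul H c y))
    = ip u u - cnj c * a - (c * cnj a - c * cnj c * of_real (r\<^sup>2))"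
    using assms ip_cnj[of u y] by (simp add: a_def r_def ip_self[of y] algebra_simps)
  also have "c * cnj c * of_real (r\<^sup>2) = c * cnj a"
    using assms by (simp add: c_def r_def power2_eq_square)
  also have "cnj c * a = of_real ((cmod a)\<^sup>2 / r\<^sup>2)"
    using sq by (simp add: c_def mult.commute)
  finally have "ip (hsub H u (hsmul H c y)) (hsub H u (hsmul H c y))
    = of_real ((hnorm H u)\<^sup>2 - (cmod a)\<^sup>2 / r\<^sup>2)"
    using assms by (simp add: ip_self)
  then show ?thesis
    using assms norm_sq[of "hsub H u (hsmul H c y)"] unfolding a_def r_def c_def
    by (metis Re_complex_of_real smul_closed sub_closed)
qed

section \<open>Subspaces, orthogonal complements and projections\<close>

definition subspace :: "'a set \<Rightarrow> bool" where
  "subspace S \<longleftrightarrow> S \<subseteq> C \<and> hzero H \<in> S \<and> (\<forall>x\<in>S. \<forall>y\<in>S. hadd H x y \<in> S)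
     \<and> (\<forall>a. \<forall>x\<in>S. hsmul H a x \<in> S)"

lemma subspace_add: "subspace S \<Longrightarrow> x \<in> S \<Longrightarrow> y \<in> S \<Longrightarrow> hadd H x y \<in> S"
  and subspace_smul: "subspace S \<Longrightarrow> x \<in> S \<Longrightarrow> hsmul H a x \<in> S"
  and subspace_zero: "subspace S \<Longrightarrow> hzero H \<in> S"
  by (auto simp: subspace_def)

text \<open>A sequence in \<open>S\<close> minimising the distance to \<open>x\<close> is Cauchy.
  Since \<open>S\<close> need not be closed, the limit \<open>l\<close> is only known to be a limit
  of points of \<open>S\<close>; this form serves both the density criterion and the projection
  theorem.\<close>

lemma orthogonal_approximation:
  assumes S: "subspace S" and x: "x \<in> C"
  obtains s l where "\<And>n::nat. s n \<in> S" "l \<in> C" "hconverges H s l"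
    "\<And>y. y \<in> S \<Longrightarrow> ip (hsub H x l) y = 0"
proof -
  have SC: "\<And>y. y \<in> S \<Longrightarrow> y \<in> C" using S by (auto simp: subspace_def)
  define d where "d = (INF y\<in>S. (hnorm H (hsub H x y))\<^sup>2)"
  have d_le: "d \<le> (hnorm H (hsub H x y))\<^sup>2" if "y \<in> S" for y
    unfolding d_def by (rule cINF_lower[OF _ that]) (auto intro!: bdd_belowI[where m=0])
  have "\<exists>y\<in>S. (hnorm H (hsub H x y))\<^sup>2 < d + inverse (real (Suc n))" for n
  proof (rule ccontr)
    assume "\<not> ?thesis"
    then have "d + inverse (real (Suc n)) \<le> d"
      unfolding d_def using S by (intro cINF_greatest) (auto simp: subspace_def not_less d_def)
    then show False by (simp add: field_simps)
  qed
  then obtain s where s: "\<And>n. s n \<in> S"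
      and sd: "\<And>n. (hnorm H (hsub H x (s n)))\<^sup>2 < d + inverse (real (Suc n))"
    by metis
  have sC: "\<And>n. s n \<in> C" using s SC by blast
  have par: "(hnorm H (hsub H (s m) (s n)))\<^sup>2 \<le> 2 * inverse (real (Suc m)) + 2 * inverse (real (Suc n))" for m n
  proof -
    \<comment> \<open>The midpoint lies in \<open>S\<close>, so its squared distance to
      \<open>x\<close> is at least \<open>d\<close>; the parallelogram law then bounds the gap
      between \<open>s m\<close> and \<open>s n\<close>.\<close>
    define y where "y = hsmul H (1/2) (hadd H (s m) (s n))"
    have "y \<in> S" using s S by (simp add: y_def subspace_def)
    moreover have "(hnorm H (hsub H (s m) (s n)))\<^sup>2 + 4 * (hnorm H (hsub H x y))\<^sup>2
       = 2 * (hnorm H (hsub H x (s m)))\<^sup>2 + 2 * (hnorm H (hsub H x (s n)))\<^sup>2"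
      unfolding y_def using x sC by (simp add: norm_sq algebra_simps)
    ultimately show ?thesis using d_le[of y] sd[of m] sd[of n] by simp
  qed
  have "hcauchy H s"
    unfolding hcauchy_def
  proof (intro allI impI)
    fix e :: real assume e: "e > 0"
    then obtain N where N: "inverse (real (Suc N)) < e\<^sup>2 / 4"
      using reals_Archimedean[of "e\<^sup>2/4"] by auto
    have "hnorm H (hsub H (s m) (s n)) < e" if "m \<ge> N" "n \<ge> N" for m n
    proof -
      have "inverse (real (Suc m)) \<le> inverse (real (Suc N))" "inverse (real (Suc n)) \<le> inverse (real (Suc N))"
        using that by (auto intro!: le_imp_inverse_le)
      then have "(hnorm H (hsub H (s m) (s n)))\<^sup>2 < e\<^sup>2" using par[of m n] N by linarith
      then show ?thesis using e by (simp add: power2_less_imp_less)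
    qed
    then show "\<exists>N. \<forall>m\<ge>N. \<forall>n\<ge>N. hnorm H (hsub H (s m) (s n)) < e" by blast
  qed
  then obtain l where l: "l \<in> C" "hconverges H s l" using complete[of s] sC by blast
  have "ip (hsub H x l) y = 0" if y: "y \<in> S" for y
  proof (rule ccontr)
    assume nz: "ip (hsub H x l) y \<noteq> 0"
    have yC: "y \<in> C" using y SC by blast
    define a where "a n = ip (hsub H x (s n)) y" for n
    define r where "r = hnorm H y"
    have r: "r \<noteq> 0" using nz norm_eq_0D[OF yC] x l by (auto simp: r_def)
    have "(cmod (a n))\<^sup>2 \<le> r\<^sup>2 * inverse (real (Suc n))" for n
    proof -
      define c where "c = a n / of_real (r\<^sup>2)"
      \<comment> \<open>Moving \<open>s n\<close> within \<open>S\<close> along \<open>y\<close>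
        lowers the squared distance to \<open>x\<close> by
        \<open>(cmod (a n))\<^sup>2 / r\<^sup>2\<close>. As \<open>s n\<close> is already almost
        optimal, this gain is at most \<open>inverse (real (Suc n))\<close>.\<close>
      define z where "z = hadd H (s n) (hsmul H c y)"
      have zS: "z \<in> S" using s y S by (simp add: z_def subspace_def)
      have "hsub H x z = hsub H (hsub H x (s n)) (hsmul H c y)"
        unfolding z_def by (rule vec_eqI) (use x sC yC in \<open>simp_all add: algebra_simps\<close>)
      then have "(hnorm H (hsub H x z))\<^sup>2 = (hnorm H (hsub H x (s n)))\<^sup>2 - (cmod (a n))\<^sup>2 / r\<^sup>2"
        using norm_sq_sub_component[OF sub_closed[OF x sC] yC r[unfolded r_def], of n]
        by (simp only: a_def r_def c_def)
      then have "(cmod (a n))\<^sup>2 / r\<^sup>2 \<le> inverse (real (Suc n))"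
        using d_le[OF zS] sd[of n] by simp
      then show ?thesis using r by (simp add: field_simps)
    qed
    moreover have "(\<lambda>n. r\<^sup>2 * inverse (real (Suc n))) \<longlonglongrightarrow> r\<^sup>2 * 0"
      by (intro tendsto_mult tendsto_const LIMSEQ_inverse_real_of_nat)
    moreover have "a \<longlonglongrightarrow> ip (hsub H x l) y"
      using tendsto_diff[OF tendsto_const[of "ip x y"] ip_tendsto[OF sC l(1) yC l(2)]] x sC yC l
      by (simp add: a_def[abs_def])
    then have "(\<lambda>n. (cmod (a n))\<^sup>2) \<longlonglongrightarrow> (cmod (ip (hsub H x l) y))\<^sup>2"
      by (intro tendsto_intros)
    ultimately have "(cmod (ip (hsub H x l) y))\<^sup>2 \<le> r\<^sup>2 * 0"
      by (intro LIMSEQ_le) auto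
    then show False using nz by simp
  qed
  then show ?thesis using that s l by blast
qed

text \<open>The residual \<open>hsub H x l\<close> of the approximation is orthogonal to
  \<open>S\<close>, hence zero, so \<open>x\<close> itself is a limit of points of
  \<open>S\<close>.\<close>

lemma dense_if_orthogonal_trivial:
  assumes S: "subspace S" and triv: "\<And>h. h \<in> C \<Longrightarrow> (\<And>y. y \<in> S \<Longrightarrow> ip h y = 0) \<Longrightarrow> h = hzero H"
  shows "hdense H S"
  unfolding hdense_def
proof (intro ballI allI impI)
  fix x and e :: real assume x: "x \<in> C" and e: "e > 0"
  obtain s l where s: "\<And>n::nat. s n \<in> S" and l: "l \<in> C" "hconverges H s l"
    and o: "\<And>y. y \<in> S \<Longrightarrow> ip (hsub H x l) y = 0"
    using orthogonal_approximation[OF S x] by metis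
  have "hsub H x l = hzero H" by (rule triv) (use x l o in \<open>simp_all del: ip_sub_left\<close>)
  then have "x = l" using sub_eq_zeroD x l by blast
  moreover obtain n where "hnorm H (hsub H (s n) l) < e"
    using l(2) e unfolding hconverges_def by blast
  ultimately show "\<exists>d\<in>S. hnorm H (hsub H x d) < e"
    using norm_sub_commute s S x unfolding subspace_def by (metis subsetD)
qed

definition orth :: "'a set \<Rightarrow> 'a set" where
  "orth S = {u \<in> C. \<forall>x\<in>S. ip x u = 0}"

lemma orthD: "u \<in> orth S \<Longrightarrow> x \<in> S \<Longrightarrow> S \<subseteq> C \<Longrightarrow> ip x u = 0 \<and> ip u x = 0"
  using ip_cnj[of x u] by (auto simp: orth_def)

lemma subspace_orth: "S \<subseteq> C \<Longrightarrow> subspace (orth S)"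
  unfolding subspace_def orth_def by (auto simp: subset_iff)

lemma closed_orth: "S \<subseteq> C \<Longrightarrow> hclosed_set H (orth S)"
  unfolding hclosed_set_def
proof (intro allI impI, elim conjE)
  fix s l assume S: "S \<subseteq> C" and s: "\<forall>n. s n \<in> orth S" and l: "l \<in> C" "hconverges H s l"
  have sC: "\<And>n. s n \<in> C" using s by (auto simp: orth_def)
  have "ip x l = 0" if x: "x \<in> S" for x
  proof -
    have xC: "x \<in> C" using x S by blast
    have "(\<lambda>n. ip (s n) x) \<longlonglongrightarrow> ip l x" using ip_tendsto[OF sC l(1) xC l(2)] .
    moreover have "ip (s n) x = 0" for n using orthD s x S by blast
    ultimately have "ip l x = 0" by (simp add: LIMSEQ_const_iff)
    then show ?thesis using ip_cnj[of l x] l xC by simp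
  qed
  then show "l \<in> orth S" using l by (simp add: orth_def)
qed

lemma projection:
  assumes S: "subspace S" and cl: "hclosed_set H S" and x: "x \<in> C"
  obtains p q where "p \<in> S" "q \<in> orth S" "x = hadd H p q"
proof -
  obtain s l where s: "\<And>n::nat. s n \<in> S" and l: "l \<in> C" "hconverges H s l"
    and o: "\<And>y. y \<in> S \<Longrightarrow> ip (hsub H x l) y = 0"
    using orthogonal_approximation[OF S x] by metis
  have "l \<in> S" using cl s l unfolding hclosed_set_def by blast
  moreover have "hsub H x l \<in> orth S"
  proof -
    have "ip y (hsub H x l) = 0" if "y \<in> S" for y
      using o[OF that] ip_cnj[of "hsub H x l" y] x l S that
      by (metis complex_cnj_zero subspace_def sub_closed subsetD)
    then show ?thesis using x l by (simp add: orth_def del: ip_sub_right)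
  qed
  moreover have "x = hadd H l (hsub H x l)"
    by (rule vec_eqI) (use x l in simp_all)
  ultimately show ?thesis using that by blast
qed

text \<open>The vector \<open>hsub H p p'\<close> equals \<open>hsub H q' q\<close>, so it lies both
  in \<open>S\<close> and in its complement and is orthogonal to itself.\<close>

lemma decomposition_unique:
  assumes S: "subspace S" and "p \<in> S" "q \<in> orth S" "p' \<in> S" "q' \<in> orth S"
    and e: "hadd H p q = hadd H p' q'"
  shows "p = p' \<and> q = q'"
proof -
  have SC: "S \<subseteq> C" using S by (simp add: subspace_def)
  have c: "p \<in> C" "q \<in> C" "p' \<in> C" "q' \<in> C" using assms SC by (auto simp: orth_def)
  have d: "hsub H p p' = hsub H q' q"
  proof (rule vec_eqI)
    fix z assume z: "z \<in> C"
    have "ip (hadd H p q) z = ip (hadd H p' q') z" using e by simp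
    then show "ip (hsub H p p') z = ip (hsub H q' q) z" using c z by (simp add: algebra_simps)
  qed (use c in simp_all)
  have "ip (hsub H p p') (hsub H p p') = ip (hsub H p p') (hsub H q' q)" using d by simp
  also have "\<dots> = 0" using c orthD[OF assms(3,2) SC] orthD[OF assms(3,4) SC]
      orthD[OF assms(5,2) SC] orthD[OF assms(5,4) SC] by simp
  finally have "p = p'" using ip_self_eq_0D sub_eq_zeroD c by simp
  moreover then have "hsub H q' q = hzero H" using d c ip_self_eq_0D[of "hsub H p' p'"]
    by (metis diff_self ip_sub_left sub_closed)
  ultimately show ?thesis using sub_eq_zeroD c by blast
qed

end

subsection \<open>Square-summable families\<close>

text \<open>The Hilbert direct sum of the subspaces \<open>S n\<close>, all taken inside the one
  space \<open>H\<close>, so that summands of different size share a single element type.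
  Unconditional summation allows any index set, in particular the integers.\<close>

definition l2sum :: "'a cspace \<Rightarrow> ('i \<Rightarrow> 'a set) \<Rightarrow> ('i \<Rightarrow> 'a) cspace" where
  "l2sum H S = \<lparr>hcarrier = {x. (\<forall>n. x n \<in> S n) \<and> (\<lambda>n. (hnorm H (x n))\<^sup>2) summable_on UNIV},
     hzero = (\<lambda>_. hzero H), hadd = (\<lambda>x y n. hadd H (x n) (y n)),
     hsmul = (\<lambda>a x n. hsmul H a (x n)), hip = (\<lambda>x y. \<Sum>\<^sub>\<infinity>n. hip H (x n) (y n))\<rparr>"

locale hilb_family = hilb H for H :: "'a cspace" +
  fixes S :: "'i \<Rightarrow> 'a set"
  assumes sub: "\<And>n. subspace (S n)" and closed: "\<And>n. hclosed_set H (S n)"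
begin

abbreviation "L \<equiv> l2sum H S"

lemma L_ops [simp]:
  "hzero L = (\<lambda>_. hzero H)" "hadd L x y = (\<lambda>n. hadd H (x n) (y n))"
  "hsmul L a x = (\<lambda>n. hsmul H a (x n))" "hip L x y = (\<Sum>\<^sub>\<infinity>n. ip (x n) (y n))"
  "hsub L x y = (\<lambda>n. hsub H (x n) (y n))"
  by (simp_all add: l2sum_def hsub_def)

lemma L_carrier: "x \<in> hcarrier L \<longleftrightarrow> (\<forall>n. x n \<in> S n) \<and> (\<lambda>n. (hnorm H (x n))\<^sup>2) summable_on UNIV"
  by (simp add: l2sum_def)

lemma S_C: "x \<in> S n \<Longrightarrow> x \<in> C"
  using sub[of n] by (auto simp: subspace_def)

lemma L_C [simp]: "x \<in> hcarrier L \<Longrightarrow> x n \<in> C"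
  using S_C by (auto simp: L_carrier)

text \<open>The parallelogram law with the square of the difference dropped.\<close>

lemma norm_sq_add_le: "x \<in> C \<Longrightarrow> y \<in> C \<Longrightarrow> (hnorm H (hadd H x y))\<^sup>2 \<le> 2 * (hnorm H x)\<^sup>2 + 2 * (hnorm H y)\<^sup>2"
  using norm_sq[of "hadd H x y"] norm_sq[of x] norm_sq[of y] norm_sq[of "hsub H x y"]
    zero_le_power2[of "hnorm H (hsub H x y)"]
  by simp

lemma L_add_closed:
  assumes x: "x \<in> hcarrier L" and y: "y \<in> hcarrier L"
  shows "hadd L x y \<in> hcarrier L"
proof -
  have "(\<lambda>n. 2 * (hnorm H (x n))\<^sup>2 + 2 * (hnorm H (y n))\<^sup>2) summable_on UNIV"
    using x y by (intro summable_on_add summable_on_cmult_right) (auto simp: L_carrier)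
  then have "(\<lambda>n. (hnorm H (hadd H (x n) (y n)))\<^sup>2) summable_on UNIV"
    by (rule summable_on_comparison_test) (use x y norm_sq_add_le in auto)
  then show ?thesis using x y sub by (auto simp: L_carrier subspace_def)
qed

lemma L_smul_closed:
  assumes x: "x \<in> hcarrier L"
  shows "hsmul L a x \<in> hcarrier L"
proof -
  have "(\<lambda>n. (cmod a)\<^sup>2 * (hnorm H (x n))\<^sup>2) summable_on UNIV"
    using x by (intro summable_on_cmult_right) (auto simp: L_carrier)
  then have "(\<lambda>n. (hnorm H (hsmul H a (x n)))\<^sup>2) summable_on UNIV"
    using x by (simp add: power_mult_distrib)
  then show ?thesis using x sub by (auto simp: L_carrier subspace_def)
qed

lemma L_sub_closed: "x \<in> hcarrier L \<Longrightarrow> y \<in> hcarrier L \<Longrightarrow> hsub L x y \<in> hcarrier L"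
  unfolding hsub_def[of L] by (intro L_add_closed L_smul_closed)

lemma L_ip_summable:
  assumes x: "x \<in> hcarrier L" and y: "y \<in> hcarrier L"
  shows "(\<lambda>n. ip (x n) (y n)) summable_on UNIV"
proof -
  have sm: "(\<lambda>n. (hnorm H (x n))\<^sup>2 + (hnorm H (y n))\<^sup>2) summable_on UNIV"
    using x y by (intro summable_on_add) (auto simp: L_carrier)
  have "cmod (ip (x n) (y n)) \<le> (hnorm H (x n))\<^sup>2 + (hnorm H (y n))\<^sup>2" for n
  proof -
    have "cmod (ip (x n) (y n)) \<le> hnorm H (x n) * hnorm H (y n)"
      using cauchy_schwarz x y by simp
    also have "\<dots> \<le> (hnorm H (x n))\<^sup>2 + (hnorm H (y n))\<^sup>2"
      using sum_squares_bound[of "hnorm H (x n)" "hnorm H (y n)"]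
        mult_nonneg_nonneg[OF norm_nonneg norm_nonneg, OF L_C[OF x] L_C[OF y], of n n]
      by linarith
    finally show ?thesis .
  qed
  then have "(\<lambda>n. norm (ip (x n) (y n))) summable_on UNIV"
    by (rule Infinite_Sum.abs_summable_on_comparison_test'[OF sm])
  then show ?thesis by (rule abs_summable_summable)
qed

lemma L_norm_sq:
  assumes x: "x \<in> hcarrier L"
  shows "hip L x x = of_real (\<Sum>\<^sub>\<infinity>n. (hnorm H (x n))\<^sup>2)" "(hnorm L x)\<^sup>2 = (\<Sum>\<^sub>\<infinity>n. (hnorm H (x n))\<^sup>2)"
    "hnorm L x \<ge> 0"
proof -
  have "((\<lambda>n. (hnorm H (x n))\<^sup>2) has_sum (\<Sum>\<^sub>\<infinity>n. (hnorm H (x n))\<^sup>2)) UNIV"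
    using x by (intro has_sum_infsum) (simp add: L_carrier)
  then have "((\<lambda>n. complex_of_real ((hnorm H (x n))\<^sup>2)) has_sum of_real (\<Sum>\<^sub>\<infinity>n. (hnorm H (x n))\<^sup>2)) UNIV"
    by (rule has_sum_of_real)
  then have "((\<lambda>n. ip (x n) (x n)) has_sum of_real (\<Sum>\<^sub>\<infinity>n. (hnorm H (x n))\<^sup>2)) UNIV"
    using x by (simp add: ip_self)
  then show 1: "hip L x x = of_real (\<Sum>\<^sub>\<infinity>n. (hnorm H (x n))\<^sup>2)"
    by (simp add: infsumI)
  have 2: "(\<Sum>\<^sub>\<infinity>n. (hnorm H (x n))\<^sup>2) \<ge> 0" by (rule infsum_nonneg) simp
  show "(hnorm L x)\<^sup>2 = (\<Sum>\<^sub>\<infinity>n. (hnorm H (x n))\<^sup>2)" "hnorm L x \<ge> 0"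
    unfolding hnorm_def[of L] 1 using 2 by simp_all
qed

lemma L_finite_sum_le:
  assumes x: "x \<in> hcarrier L" and F: "finite F"
  shows "(\<Sum>n\<in>F. (hnorm H (x n))\<^sup>2) \<le> (hnorm L x)\<^sup>2"
  unfolding L_norm_sq(2)[OF x]
  by (rule finite_sum_le_infsum) (use x F in \<open>auto simp: L_carrier\<close>)

lemma L_coord_le: "x \<in> hcarrier L \<Longrightarrow> hnorm H (x n) \<le> hnorm L x"
  using L_finite_sum_le[of x "{n}"] L_norm_sq(3)[of x] by - (rule power2_le_imp_le, simp_all)

text \<open>The limit is formed coordinatewise. The Cauchy bound holds for every finite partial sum,
  survives the limit there, and so yields both square summability of the limit and convergence in
  norm.\<close>

lemma L_complete:
  assumes s: "\<And>k. s k \<in> hcarrier L" and cau: "hcauchy L s"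
  shows "\<exists>l\<in>hcarrier L. hconverges L s l"
proof -
  have sC: "\<And>k n. s k n \<in> C" using s by simp
  have sS: "\<And>k n. s k n \<in> S n" using s by (simp add: L_carrier)
  have coord: "hnorm H (hsub H (s m n) (s k n)) \<le> hnorm L (hsub L (s m) (s k))" for m k n
    using L_coord_le[OF L_sub_closed[OF s s], of m k n] by simp
  have "hcauchy H (\<lambda>k. s k n)" for n
    unfolding hcauchy_def
  proof (intro allI impI)
    fix e :: real assume "e > 0"
    then obtain N where "\<forall>m\<ge>N. \<forall>k\<ge>N. hnorm L (hsub L (s m) (s k)) < e"
      using cau unfolding hcauchy_def by blast
    then show "\<exists>N. \<forall>m\<ge>N. \<forall>k\<ge>N. hnorm H (hsub H (s m n) (s k n)) < e"
      using coord by (meson le_less_trans)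
  qed
  then have "\<forall>n. \<exists>l\<in>C. hconverges H (\<lambda>k. s k n) l"
    by (intro allI complete sC)
  then obtain l where lC: "\<And>n. l n \<in> C" and l: "\<And>n. hconverges H (\<lambda>k. s k n) (l n)"
    by metis
  have lS: "l n \<in> S n" for n
    using closed[of n, unfolded hclosed_set_def, rule_format, of "\<lambda>k. s k n" "l n"] sS lC l by simp
  have main: "\<exists>N. \<forall>m\<ge>N. \<forall>F. finite F \<longrightarrow> (\<Sum>n\<in>F. (hnorm H (hsub H (s m n) (l n)))\<^sup>2) \<le> e\<^sup>2"
    if e: "e > 0" for e
  proof -
    obtain N where N: "\<And>m k. m \<ge> N \<Longrightarrow> k \<ge> N \<Longrightarrow> hnorm L (hsub L (s m) (s k)) < e"
      using cau e unfolding hcauchy_def by blast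
    have "(\<Sum>n\<in>F. (hnorm H (hsub H (s m n) (l n)))\<^sup>2) \<le> e\<^sup>2" if m: "m \<ge> N" and F: "finite F" for m F
    proof (rule LIMSEQ_le_const2)
      show "(\<lambda>k. \<Sum>n\<in>F. (hnorm H (hsub H (s m n) (s k n)))\<^sup>2) \<longlonglongrightarrow> (\<Sum>n\<in>F. (hnorm H (hsub H (s m n) (l n)))\<^sup>2)"
        by (intro tendsto_sum tendsto_power norm_sub_tendsto sC lC l)
      have "(\<Sum>n\<in>F. (hnorm H (hsub H (s m n) (s k n)))\<^sup>2) \<le> e\<^sup>2" if "k \<ge> N" for k
      proof -
        have "(\<Sum>n\<in>F. (hnorm H (hsub H (s m n) (s k n)))\<^sup>2) \<le> (hnorm L (hsub L (s m) (s k)))\<^sup>2"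
          using L_finite_sum_le[OF L_sub_closed[OF s s] F, of m k] by simp
        also have "\<dots> \<le> e\<^sup>2"
          using N[OF m that] L_norm_sq(3)[OF L_sub_closed[OF s s], of m k]
          by (intro power_mono) auto
        finally show ?thesis .
      qed
      then show "\<exists>N. \<forall>k\<ge>N. (\<Sum>n\<in>F. (hnorm H (hsub H (s m n) (s k n)))\<^sup>2) \<le> e\<^sup>2" by blast
    qed
    then show ?thesis by blast
  qed
  have diff: "hsub L (s m) l \<in> hcarrier L"
    if "\<forall>F. finite F \<longrightarrow> (\<Sum>n\<in>F. (hnorm H (hsub H (s m n) (l n)))\<^sup>2) \<le> e\<^sup>2" for m e
  proof -
    have "(\<lambda>n. (hnorm H (hsub H (s m n) (l n)))\<^sup>2) summable_on UNIV"
      by (rule nonneg_bdd_above_summable_on) (use that in \<open>auto intro!: bdd_aboveI[where M="e\<^sup>2"]\<close>)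
    moreover have "hsub H (s m n) (l n) \<in> S n" for n
      using sS lS sub[of n] by (simp add: hsub_def subspace_def)
    ultimately show ?thesis by (simp add: L_carrier)
  qed
  obtain N where N: "\<forall>m\<ge>N. \<forall>F. finite F \<longrightarrow> (\<Sum>n\<in>F. (hnorm H (hsub H (s m n) (l n)))\<^sup>2) \<le> 1\<^sup>2"
    using main[of 1] by auto
  then have "hsub L (s N) (hsub L (s N) l) \<in> hcarrier L"
    using L_sub_closed[OF s diff[of N 1]] by simp
  \<comment> \<open>Only the difference from \<open>s N\<close> is known to be square summable so
    far; subtracting it from \<open>s N\<close> recovers \<open>l\<close>.\<close>
  moreover have "hsub L (s N) (hsub L (s N) l) = l"
    using sC lC by (auto intro!: vec_eqI)
  ultimately have lL: "l \<in> hcarrier L" by simp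
  have "hconverges L s l"
    unfolding hconverges_def
  proof (intro allI impI)
    fix e :: real assume e: "e > 0"
    obtain N where N: "\<And>m F. m \<ge> N \<Longrightarrow> finite F \<Longrightarrow> (\<Sum>n\<in>F. (hnorm H (hsub H (s m n) (l n)))\<^sup>2) \<le> (e/2)\<^sup>2"
      using main[of "e/2"] e by auto
    have "hnorm L (hsub L (s m) l) < e" if m: "m \<ge> N" for m
    proof -
      have d: "hsub L (s m) l \<in> hcarrier L" by (rule L_sub_closed[OF s lL])
      have "(hnorm L (hsub L (s m) l))\<^sup>2 \<le> (e/2)\<^sup>2"
        unfolding L_norm_sq(2)[OF d]
        by (rule infsum_le_finite_sums) (use d N[OF m] in \<open>auto simp: L_carrier\<close>)
      then have "hnorm L (hsub L (s m) l) \<le> e/2" by (rule power2_le_imp_le) (use e in simp)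
      then show ?thesis using e by simp
    qed
    then show "\<exists>N. \<forall>m\<ge>N. hnorm L (hsub L (s m) l) < e" by blast
  qed
  then show ?thesis using lL by blast
qed

lemma hilbert_space_L: "hilbert_space L"
  unfolding hilbert_space_def
proof (intro conjI ballI allI impI, goal_cases)
  case 1 show ?case using sub by (auto simp: L_carrier subspace_def)
next
  case (2 x y) then show ?case by (rule L_add_closed)
next
  case (3 a x) then show ?case by (rule L_smul_closed)
next
  case (4 x y z) then show ?case by (auto intro!: vec_eqI)
next
  case (5 x y) then show ?case by (auto intro!: vec_eqI)
next
  case (6 x) then show ?case by (auto simp: add_zero_left)
next
  case (7 x)
  have "hadd L x (hsmul L (-1) x) = hzero L" using 7 by (auto intro!: vec_eqI)
  then show ?case using L_smul_closed[OF 7] by blast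
next
  case (8 a x y) then show ?case by (auto intro!: vec_eqI simp: algebra_simps)
next
  case (9 a b x) then show ?case by (auto intro!: vec_eqI simp: algebra_simps)
next
  case (10 a b x) then show ?case by (auto intro!: vec_eqI)
next
  case (11 x) then show ?case by (auto simp: smul_one)
next
  case (12 x y z) then show ?case
    using infsum_add[OF L_ip_summable[of x z] L_ip_summable[of y z]] by simp
next
  case (13 a x y) then show ?case by (simp add: infsum_cmult_right')
next
  case (14 x y)
  then have "(\<lambda>n. ip (y n) (x n)) = (\<lambda>n. cnj (ip (x n) (y n)))" by (auto intro!: ip_cnj)
  then show ?case by simp
next
  case (15 x) then show ?case using L_norm_sq(1)[of x] by (auto intro!: infsum_nonneg simp del: L_ops)
next
  case (16 x)
  then have z: "(\<Sum>\<^sub>\<infinity>n. (hnorm H (x n))\<^sup>2) = 0" using L_norm_sq(1)[of x] by simp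
  have "(hnorm H (x n))\<^sup>2 = 0" for n
    by (rule nonneg_infsum_le_0D[of _ UNIV]) (use 16 z in \<open>auto simp: L_carrier\<close>)
  then show ?case using 16 norm_eq_0D by auto
next
  case (17 s) then show ?case using L_complete by blast
qed

end

subsection \<open>Transport of structure\<close>

text \<open>The copy of a Hilbert space along a map injective on its carrier. It moves the dilation
  space, whose vectors are functions on the integers, to the element type prescribed for the
  extension space.\<close>

definition transport :: "('b \<Rightarrow> 'c) \<Rightarrow> 'b cspace \<Rightarrow> 'c cspace" where
  "transport e H = (let d = inv_into (hcarrier H) e in
     \<lparr>hcarrier = e ` hcarrier H, hzero = e (hzero H), hadd = (\<lambda>x y. e (hadd H (d x) (d y))),
      hsmul = (\<lambda>a x. e (hsmul H a (d x))), hip = (\<lambda>x y. hip H (d x) (d y))\<rparr>)"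

context hilb
begin

context
  fixes e :: "'a \<Rightarrow> 'c"
  assumes inj: "inj_on e C"
begin

abbreviation "H' \<equiv> transport e H"

lemma transport_carrier: "hcarrier H' = e ` C"
  by (simp add: transport_def Let_def)

lemma transport_ops [simp]:
  "hzero H' = e (hzero H)"
  "x \<in> C \<Longrightarrow> y \<in> C \<Longrightarrow> hadd H' (e x) (e y) = e (hadd H x y)"
  "x \<in> C \<Longrightarrow> hsmul H' a (e x) = e (hsmul H a x)"
  "x \<in> C \<Longrightarrow> y \<in> C \<Longrightarrow> hip H' (e x) (e y) = ip x y"
  "x \<in> C \<Longrightarrow> y \<in> C \<Longrightarrow> hsub H' (e x) (e y) = e (hsub H x y)"
  "x \<in> C \<Longrightarrow> hnorm H' (e x) = hnorm H x"
  using inj by (simp_all add: transport_def Let_def hsub_def hnorm_def)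

lemma transport_complete:
  assumes s: "\<And>n. s n \<in> hcarrier H'" and cau: "hcauchy H' s"
  shows "\<exists>l\<in>hcarrier H'. hconverges H' s l"
proof -
  obtain t where t: "\<And>n. t n \<in> C" "\<And>n. s n = e (t n)"
    using s unfolding transport_carrier image_iff by metis
  have "hcauchy H t" using cau t by (simp add: hcauchy_def)
  then obtain l where l: "l \<in> C" "hconverges H t l" using complete t by blast
  then have "hconverges H' s (e l)" using t by (simp add: hconverges_def)
  then show ?thesis using l transport_carrier by blast
qed

lemma hilbert_space_transport: "hilbert_space H'"
  unfolding hilbert_space_def
proof (intro conjI ballI allI impI, goal_cases)
  case 17
  then show ?case using transport_complete by blast
next
  case (7 x)
  then obtain u where u: "u \<in> C" "x = e u" by (auto simp: transport_carrier)
  have "hadd H u (hsmul H (-1) u) = hzero H" by (rule vec_eqI) (use u in simp_all)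
  then have "hadd H' x (e (hsmul H (-1) u)) = hzero H'" using u by simp
  then show ?case using u by (auto simp: transport_carrier)
next
  case (14 x y)
  then obtain u v where "u \<in> C" "v \<in> C" "x = e u" "y = e v" by (auto simp: transport_carrier)
  then show ?case using ip_cnj[of u v] by simp
next
  case (16 x)
  then show ?case using ip_self_eq_0D by (auto simp: transport_carrier)
qed (auto simp: transport_carrier ip_nonneg algebra_simps
    intro!: arg_cong[where f=e] vec_eqI)

end

end

subsection \<open>Inverse Cayley transform of a unitary operator\<close>

text \<open>Absence of the eigenvalue 1 makes the inverse Cayley transform single-valued and densely
  defined; absence of the eigenvalue -1 makes it injective.\<close>

locale unitary_no_fixed = hilb H for H :: "'a cspace" +
  fixes U :: "'a \<Rightarrow> 'a"
  assumes U_closed [simp]: "x \<in> C \<Longrightarrow> U x \<in> C"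
    and U_add: "x \<in> C \<Longrightarrow> y \<in> C \<Longrightarrow> U (hadd H x y) = hadd H (U x) (U y)"
    and U_smul: "x \<in> C \<Longrightarrow> U (hsmul H a x) = hsmul H a (U x)"
    and U_ip: "x \<in> C \<Longrightarrow> y \<in> C \<Longrightarrow> ip (U x) (U y) = ip x y"
    and U_surj: "y \<in> C \<Longrightarrow> \<exists>x\<in>C. U x = y"
    and U_fixed: "x \<in> C \<Longrightarrow> U x = x \<Longrightarrow> x = hzero H"
    and U_antifixed: "x \<in> C \<Longrightarrow> U x = hsmul H (-1) x \<Longrightarrow> x = hzero H"
begin

lemma U_sub: "x \<in> C \<Longrightarrow> y \<in> C \<Longrightarrow> U (hsub H x y) = hsub H (U x) (U y)"
  by (simp add: hsub_def U_add U_smul)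

definition "K y = hsub H y (U y)"
definition "dom_cayley = K ` C"
text \<open>The operator \<open>\<i>(1 + U)(1 - U)\<^sup>-\<^sup>1\<close>, where \<open>K\<close>
  is \<open>1 - U\<close>. Since \<open>K\<close> is injective on the carrier, proofs parametrise
  the domain by \<open>K y\<close>.\<close>

definition "cayley x = (let y = inv_into C K x in hsmul H \<i> (hadd H y (U y)))"

lemma K_closed [simp]: "y \<in> C \<Longrightarrow> K y \<in> C"
  by (simp add: K_def)

lemma K_add: "x \<in> C \<Longrightarrow> y \<in> C \<Longrightarrow> K (hadd H x y) = hadd H (K x) (K y)"
  unfolding K_def by (rule vec_eqI) (simp_all add: U_add)

lemma K_smul: "x \<in> C \<Longrightarrow> K (hsmul H a x) = hsmul H a (K x)"
  unfolding K_def by (rule vec_eqI) (simp_all add: U_smul algebra_simps)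

lemma inj_K: "inj_on K C"
proof (rule inj_onI)
  fix x y assume xy: "x \<in> C" "y \<in> C" "K x = K y"
  have "U (hsub H x y) = hsub H x y"
  proof (rule vec_eqI)
    fix z assume z: "z \<in> C"
    have "ip (K x) z = ip (K y) z" using xy by simp
    then show "ip (U (hsub H x y)) z = ip (hsub H x y) z"
      using xy z by (simp add: K_def U_sub algebra_simps)
  qed (use xy in simp_all)
  then show "x = y" using U_fixed[of "hsub H x y"] sub_eq_zeroD xy sub_closed by blast
qed

lemma cayley_K: "y \<in> C \<Longrightarrow> cayley (K y) = hsmul H \<i> (hadd H y (U y))"
  by (simp add: cayley_def inj_K)

lemma linear_cayley: "linear_operator H dom_cayley cayley"
  unfolding linear_operator_def
proof (intro conjI ballI allI)
  show "dom_cayley \<subseteq> C" by (auto simp: dom_cayley_def)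
  have "K (hzero H) = hzero H"
    using K_smul[of "hzero H" 0] smul_zero_left[of "hzero H"] smul_zero_left[of "K (hzero H)"] by simp
  then show "hzero H \<in> dom_cayley" unfolding dom_cayley_def by (metis imageI zero_closed)
next
  fix x y assume "x \<in> dom_cayley" "y \<in> dom_cayley"
  then obtain u v where uv: "u \<in> C" "v \<in> C" "x = K u" "y = K v" by (auto simp: dom_cayley_def)
  then have s: "hadd H x y = K (hadd H u v)" by (simp add: K_add)
  then show "hadd H x y \<in> dom_cayley" using uv by (simp add: dom_cayley_def)
  show "cayley (hadd H x y) = hadd H (cayley x) (cayley y)"
    unfolding s using uv by (auto simp: cayley_K U_add algebra_simps intro!: vec_eqI)
next
  fix a x assume "x \<in> dom_cayley"
  then obtain u where u: "u \<in> C" "x = K u" by (auto simp: dom_cayley_def)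
  then have s: "hsmul H a x = K (hsmul H a u)" by (simp add: K_smul)
  then show "hsmul H a x \<in> dom_cayley" using u by (simp add: dom_cayley_def)
  show "cayley (hsmul H a x) = hsmul H a (cayley x)"
    unfolding s using u by (auto simp: cayley_K U_smul algebra_simps intro!: vec_eqI)
next
  fix x assume "x \<in> dom_cayley"
  then show "cayley x \<in> C" by (auto simp: dom_cayley_def cayley_K)
qed

text \<open>If \<open>h\<close> is orthogonal to the range of \<open>1 - U\<close>, then
  \<open>h\<close> and \<open>U h\<close> have the same inner product with every \<open>U y\<close>.
  These vectors exhaust the space, so \<open>h\<close> is fixed by \<open>U\<close>.\<close>

lemma dense_cayley: "hdense H dom_cayley"
proof (rule dense_if_orthogonal_trivial)
  show "subspace dom_cayley" using linear_cayley by (simp add: linear_operator_def subspace_def)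
  fix h assume h: "h \<in> C" and o: "\<And>y. y \<in> dom_cayley \<Longrightarrow> ip h y = 0"
  have "U h = h"
  proof (rule vec_eqI)
    fix z assume "z \<in> C"
    then obtain y where y: "y \<in> C" "z = U y" using U_surj by blast
    have "ip h (K y) = 0" using o y by (simp add: dom_cayley_def)
    then show "ip (U h) z = ip h z" using y h by (simp add: K_def U_ip)
  qed (use h in simp_all)
  then show "h = hzero H" using U_fixed h by blast
qed

lemma adjoint_cayley: "adjoint_graph H dom_cayley cayley = op_graph dom_cayley cayley"
proof (intro set_eqI iffI)
  fix p assume "p \<in> op_graph dom_cayley cayley"
  then obtain u where u: "u \<in> C" "p = (K u, cayley (K u))" by (auto simp: op_graph_def dom_cayley_def)
  \<comment> \<open>After expansion the terms \<open>ip v u\<close> and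
    \<open>ip (U v) (U u)\<close> cancel because \<open>U\<close> is isometric, and the mixed terms
    agree.\<close>
  have "ip (cayley (K v)) (K u) = ip (K v) (cayley (K u))" if "v \<in> C" for v
    using u that by (simp add: cayley_K) (simp add: K_def U_ip algebra_simps)
  then show "p \<in> adjoint_graph H dom_cayley cayley"
    using u by (auto simp: adjoint_graph_def dom_cayley_def cayley_K)
next
  fix p assume "p \<in> adjoint_graph H dom_cayley cayley"
  then obtain g w where p: "p = (g, w)" and g: "g \<in> C" and w: "w \<in> C"
    and adj: "\<And>x. x \<in> dom_cayley \<Longrightarrow> ip (cayley x) g = ip x w"
    by (auto simp: adjoint_graph_def)
  \<comment> \<open>If \<open>g\<close> were \<open>K y\<close> and \<open>w\<close> its image,
    these two vectors would be \<open>2\<i>\<close> times \<open>y\<close> and \<open>U y\<close>.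
    The adjoint identity forces \<open>U a = b\<close>, and dividing by \<open>2\<i>\<close> then
    produces such a \<open>y\<close>.\<close>
  define a where "a = hadd H w (hsmul H \<i> g)"
  define b where "b = hsub H w (hsmul H \<i> g)"
  have aC: "a \<in> C" and bC: "b \<in> C" using g w by (simp_all add: a_def b_def)
  have "U a = b"
  proof (rule vec_eqI)
    fix z assume z: "z \<in> C"
    then obtain y where y: "y \<in> C" "z = U y" using U_surj by blast
    have "ip (cayley (K y)) g = ip (K y) w" using adj y by (simp add: dom_cayley_def)
    then have "ip y a = ip (U y) b"
      using y g w by (simp add: cayley_K) (simp add: K_def a_def b_def algebra_simps)
    then have "ip z (U a) = ip z b" using y aC by (simp add: U_ip)
    then show "ip (U a) z = ip b z" using ip_cnj[of z "U a"] ip_cnj[of z b] z aC bC by simp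
  qed (use aC bC in simp_all)
  define y where "y = hsmul H (1 / (2 * \<i>)) a"
  have y: "y \<in> C" "U y = hsmul H (1 / (2 * \<i>)) b"
    using aC \<open>U a = b\<close> by (simp_all add: y_def U_smul)
  have "K y = g" unfolding K_def y(2)
    by (rule vec_eqI) (use g w y_def in \<open>simp_all add: a_def b_def field_simps\<close>)
  moreover have "hsmul H \<i> (hadd H y (U y)) = w" unfolding y(2)
    by (rule vec_eqI) (use g w y_def in \<open>simp_all add: a_def b_def field_simps\<close>)
  ultimately show "p \<in> op_graph dom_cayley cayley"
    using p y cayley_K[of y] by (auto simp: op_graph_def dom_cayley_def)
qed

lemma self_adjoint_cayley: "self_adjoint H dom_cayley cayley"
  unfolding self_adjoint_def using linear_cayley dense_cayley adjoint_cayley by blast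

lemma inj_cayley: "inj_on cayley dom_cayley"
proof (rule inj_onI)
  fix x y assume xy: "x \<in> dom_cayley" "y \<in> dom_cayley" "cayley x = cayley y"
  then obtain u v where uv: "u \<in> C" "v \<in> C" "x = K u" "y = K v" by (auto simp: dom_cayley_def)
  have "U (hsub H u v) = hsmul H (-1) (hsub H u v)"
  proof (rule vec_eqI)
    fix z assume z: "z \<in> C"
    have "ip (cayley x) z = ip (cayley y) z" using xy by simp
    then have "\<i> * (ip u z + ip (U u) z) = \<i> * (ip v z + ip (U v) z)"
      using uv z by (simp add: cayley_K)
    then have "ip u z + ip (U u) z = ip v z + ip (U v) z" by simp
    then show "ip (U (hsub H u v)) z = ip (hsmul H (-1) (hsub H u v)) z"
      using uv z by (simp add: U_sub algebra_simps)
  qed (use uv in simp_all)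
  then have "hsub H u v = hzero H" using U_antifixed uv by simp
  then show "x = y" using sub_eq_zeroD uv by blast
qed

end

subsection \<open>Unitary dilation of a partial isometry\<close>

text \<open>Meant for the dilation and its inverse, which act as a shift except at two
  indices.\<close>

lemma summable_on_finite_change:
  fixes f g :: "'i \<Rightarrow> real"
  assumes g: "g summable_on UNIV" and fin: "finite F" and eq: "\<And>n. n \<notin> F \<Longrightarrow> f n = g n"
  shows "f summable_on UNIV"
proof -
  have "((\<lambda>n. f n - g n) has_sum (\<Sum>n\<in>F. f n - g n)) UNIV"
    by (rule has_sum_finite_neutralI[OF fin]) (use eq in auto)
  then have "(\<lambda>n. g n + (f n - g n)) summable_on UNIV"
    by (intro summable_on_add g) (rule has_sum_imp_summable)
  then show ?thesis by simp
qed

text \<open>Rules out nonzero vectors whose norm is constant along a tail.\<close>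

lemma summable_on_constant_subsequence:
  fixes f :: "'i \<Rightarrow> real" and h :: "nat \<Rightarrow> 'i"
  assumes f: "f summable_on UNIV" and h: "inj h" and c: "\<And>k. f (h k) = c"
  shows "c = 0"
proof -
  have "f summable_on range h" by (rule summable_on_subset_banach[OF f]) simp
  then have "(f \<circ> h) summable_on UNIV" using summable_on_reindex[OF h] by blast
  then have "summable (\<lambda>k. c)" using summable_on_imp_summable c by (simp add: o_def)
  then have "(\<lambda>k::nat. c) \<longlonglongrightarrow> 0" by (rule summable_LIMSEQ_zero)
  then show ?thesis by (simp add: LIMSEQ_const_iff)
qed

text \<open>The map \<open>V\<close> is specified only on \<open>M\<close>; the extension by zero
  arises from composing it with the orthogonal projection onto \<open>M\<close>.\<close>

locale partial_isometry = hilb H for H :: "'a cspace" +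
  fixes M M' :: "'a set" and V :: "'a \<Rightarrow> 'a"
  assumes M: "subspace M" "hclosed_set H M"
    and M': "subspace M'" "hclosed_set H M'"
    and V_in: "x \<in> M \<Longrightarrow> V x \<in> M'"
    and V_add: "x \<in> M \<Longrightarrow> y \<in> M \<Longrightarrow> V (hadd H x y) = hadd H (V x) (V y)"
    and V_smul: "x \<in> M \<Longrightarrow> V (hsmul H a x) = hsmul H a (V x)"
    and V_ip: "x \<in> M \<Longrightarrow> y \<in> M \<Longrightarrow> ip (V x) (V y) = ip x y"
    and V_surj: "y \<in> M' \<Longrightarrow> \<exists>x\<in>M. V x = y"
    and V_eigen: "a \<in> {1, -1} \<Longrightarrow> x \<in> M \<Longrightarrow> V x = hsmul H a x \<Longrightarrow> x = hzero H"
begin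

section \<open>Orthogonal splitting along the initial space\<close>

lemma MC: "x \<in> M \<Longrightarrow> x \<in> C" "x \<in> M' \<Longrightarrow> x \<in> C" "x \<in> orth M \<Longrightarrow> x \<in> C" "x \<in> orth M' \<Longrightarrow> x \<in> C"
  using M M' by (auto simp: subspace_def orth_def)

lemma M_subset: "M \<subseteq> C" "M' \<subseteq> C"
  using MC by auto

lemma sub_orth: "subspace (orth M)" "subspace (orth M')"
  using subspace_orth M_subset by auto

text \<open>The orthogonal projections onto \<open>M\<close> and onto its complement. The choice of
  \<open>Q x\<close> refers to \<open>P x\<close>, so that the two always belong to the same
  decomposition.\<close>

definition "P x = (SOME p. p \<in> M \<and> (\<exists>q\<in>orth M. x = hadd H p q))"
definition "Q x = (SOME q. q \<in> orth M \<and> x = hadd H (P x) q)"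

lemma PQ:
  assumes "x \<in> C"
  shows "P x \<in> M" "Q x \<in> orth M" "x = hadd H (P x) (Q x)"
proof -
  have "\<exists>p. p \<in> M \<and> (\<exists>q\<in>orth M. x = hadd H p q)"
    using projection[OF M assms] by metis
  from someI_ex[OF this] have P: "P x \<in> M" "\<exists>q. q \<in> orth M \<and> x = hadd H (P x) q"
    by (auto simp: P_def)
  from P(1) show "P x \<in> M" .
  from someI_ex[OF P(2)] show "Q x \<in> orth M" "x = hadd H (P x) (Q x)" by (auto simp: Q_def)
qed

lemma PQ_C [simp]: "x \<in> C \<Longrightarrow> P x \<in> C" "x \<in> C \<Longrightarrow> Q x \<in> C" "x \<in> C \<Longrightarrow> V (P x) \<in> C"
  using PQ MC V_in by blast+

lemma PQ_unique: "p \<in> M \<Longrightarrow> q \<in> orth M \<Longrightarrow> P (hadd H p q) = p \<and> Q (hadd H p q) = q"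
  using decomposition_unique[OF M(1) _ _ PQ(1,2), of p q "hadd H p q"] PQ(3)[of "hadd H p q"] MC
  by (metis add_closed)

lemma PQ_M: "p \<in> M \<Longrightarrow> P p = p \<and> Q p = hzero H"
  using PQ_unique[of p "hzero H"] subspace_zero[OF sub_orth(1)] MC by (simp add: add_zero_right)

lemma PQ_add:
  assumes "x \<in> C" "y \<in> C"
  shows "P (hadd H x y) = hadd H (P x) (P y) \<and> Q (hadd H x y) = hadd H (Q x) (Q y)"
proof -
  have "hadd H x y = hadd H (hadd H (P x) (Q x)) (hadd H (P y) (Q y))" using PQ(3) assms by metis
  also have "\<dots> = hadd H (hadd H (P x) (P y)) (hadd H (Q x) (Q y))"
    by (rule vec_eqI) (use assms in simp_all)
  finally show ?thesis
    using PQ_unique[of "hadd H (P x) (P y)" "hadd H (Q x) (Q y)"] PQ assms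
      subspace_add[OF M(1)] subspace_add[OF sub_orth(1)] by metis
qed

lemma PQ_smul:
  assumes "x \<in> C"
  shows "P (hsmul H a x) = hsmul H a (P x) \<and> Q (hsmul H a x) = hsmul H a (Q x)"
proof -
  have "hsmul H a x = hsmul H a (hadd H (P x) (Q x))" using PQ(3) assms by metis
  also have "\<dots> = hadd H (hsmul H a (P x)) (hsmul H a (Q x))"
    by (rule vec_eqI) (use assms in \<open>simp_all add: algebra_simps\<close>)
  finally show ?thesis
    using PQ_unique[of "hsmul H a (P x)" "hsmul H a (Q x)"] PQ assms
      subspace_smul[OF M(1)] subspace_smul[OF sub_orth(1)] by metis
qed

lemma ip_PQ:
  assumes "x \<in> C" "y \<in> C"
  shows "ip x y = ip (P x) (P y) + ip (Q x) (Q y)"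
proof -
  have "ip x y = ip (hadd H (P x) (Q x)) (hadd H (P y) (Q y))" using PQ(3) assms by metis
  also have "\<dots> = ip (P x) (P y) + ip (Q x) (Q y)"
    using orthD[OF PQ(2) PQ(1) M_subset(1), of x y] orthD[OF PQ(2) PQ(1) M_subset(1), of y x] assms
    by simp
  finally show ?thesis .
qed

section \<open>The dilation on the two-sided sum\<close>

definition S :: "int \<Rightarrow> 'a set" where
  "S n = (if n = 0 then C else if n > 0 then orth M else orth M')"

lemma S_simps [simp]: "S 0 = C" "n > 0 \<Longrightarrow> S n = orth M" "n < 0 \<Longrightarrow> S n = orth M'"
  by (auto simp: S_def)

sublocale F: hilb_family H S
proof unfold_locales
  fix n show "subspace (S n)" using sub_orth by (simp add: S_def) (simp add: subspace_def)
  show "hclosed_set H (S n)"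
    using closed_orth M_subset by (simp add: S_def) (simp add: hclosed_set_def)
qed

sublocale L: hilb F.L
  by unfold_locales (rule F.hilbert_space_L)

text \<open>Apart from the shift there is one block: the pair of coordinates 0 and -1, in
  \<open>H\<close> and the complement of \<open>M'\<close>, goes to the pair of coordinates 0 and 1,
  in \<open>H\<close> and the complement of \<open>M\<close>. That block is unitary because
  \<open>V\<close> maps \<open>M\<close> isometrically onto \<open>M'\<close>.\<close>

definition U :: "(int \<Rightarrow> 'a) \<Rightarrow> int \<Rightarrow> 'a" where
  "U x n = (if n = 0 then hadd H (V (P (x 0))) (x (-1)) else if n = 1 then Q (x 0) else x (n - 1))"

lemma LS: "x \<in> hcarrier F.L \<Longrightarrow> x n \<in> S n"
  by (simp add: F.L_carrier)

lemma shift_bij: "bij (\<lambda>n::int. n + a)"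
  by (rule bij_betw_byWitness[where f'="\<lambda>n. n - a"]) auto

lemma shift_summable:
  "x \<in> hcarrier F.L \<Longrightarrow> (\<lambda>n. (hnorm H (x (n + a)))\<^sup>2) summable_on UNIV"
  using summable_on_reindex_bij_betw[OF shift_bij[of a], where f="\<lambda>n. (hnorm H (x n))\<^sup>2"]
  by (simp add: F.L_carrier)

lemma U_closed:
  assumes x: "x \<in> hcarrier F.L"
  shows "U x \<in> hcarrier F.L"
proof -
  have "(\<lambda>n. (hnorm H (U x n))\<^sup>2) summable_on UNIV"
    by (rule summable_on_finite_change[OF shift_summable[OF x, of "-1"], of "{0, 1}"]) (auto simp: U_def)
  moreover have "U x n \<in> S n" for n
  proof -
    consider "n = 0" | "n = 1" | "n > 1" | "n < 0" by linarith
    then show ?thesis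
    proof cases
      case 3 then show ?thesis using LS[OF x, of "n - 1"] by (simp add: U_def)
    next
      case 4 then show ?thesis using LS[OF x, of "n - 1"] by (simp add: U_def)
    qed (use x PQ in \<open>simp_all add: U_def\<close>)
  qed
  ultimately show ?thesis by (simp add: F.L_carrier)
qed

lemma U_add:
  assumes "x \<in> hcarrier F.L" "y \<in> hcarrier F.L"
  shows "U (hadd F.L x y) = hadd F.L (U x) (U y)"
proof
  fix n
  show "U (hadd F.L x y) n = hadd F.L (U x) (U y) n"
    using assms PQ(1) by (auto simp: U_def PQ_add V_add intro!: vec_eqI)
qed

lemma U_smul:
  assumes "x \<in> hcarrier F.L"
  shows "U (hsmul F.L a x) = hsmul F.L a (U x)"
proof
  fix n
  show "U (hsmul F.L a x) n = hsmul F.L a (U x) n"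
    using assms PQ(1) by (auto simp: U_def PQ_smul V_smul algebra_simps intro!: vec_eqI)
qed

lemma U_ip:
  assumes x: "x \<in> hcarrier F.L" and y: "y \<in> hcarrier F.L"
  shows "hip F.L (U x) (U y) = hip F.L x y"
proof -
  define c where "c = ip (P (x 0)) (P (y 0))"
  \<comment> \<open>Compared with a pure shift, index 0 gains the contribution of the
    \<open>M\<close>-components and index 1 lacks it; the two corrections cancel in the sum.\<close>
  define corr :: "int \<Rightarrow> complex" where "corr n = (if n = 0 then c else if n = 1 then - c else 0)" for n
  have xy: "x n \<in> C" "y n \<in> C" for n using x y by simp_all
  have *: "ip (U x n) (U y n) = ip (x (n + (-1))) (y (n + (-1))) + corr n" for n
  proof -
    consider "n = 0" | "n = 1" | "n \<noteq> 0" "n \<noteq> 1" by blast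
    then show ?thesis
    proof cases
      case 1
      have o: "x (-1) \<in> orth M'" "y (-1) \<in> orth M'" using LS[OF x, of "-1"] LS[OF y, of "-1"] by simp_all
      have v: "V (P (x 0)) \<in> M'" "V (P (y 0)) \<in> M'" using V_in PQ(1) xy by simp_all
      show ?thesis
        using orthD[OF o(1) v(2) M_subset(2)] orthD[OF o(2) v(1) M_subset(2)] xy 1 PQ(1)
        by (simp add: U_def corr_def c_def V_ip)
    next
      case 2
      then show ?thesis using ip_PQ[of "x 0" "y 0"] xy by (simp add: U_def corr_def c_def)
    next
      case 3
      then show ?thesis by (simp add: U_def corr_def)
    qed
  qed
  have "((\<lambda>n. ip (x (n + (-1))) (y (n + (-1)))) has_sum hip F.L x y) UNIV"
    using has_sum_infsum[OF F.L_ip_summable[OF x y]]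
      has_sum_reindex_bij_betw[OF shift_bij[of "-1"], where f="\<lambda>n. ip (x n) (y n)"] by simp
  moreover have "(corr has_sum 0) UNIV"
    by (rule has_sum_finite_neutralI[of "{0, 1}"]) (auto simp: corr_def)
  ultimately have "((\<lambda>n. ip (U x n) (U y n)) has_sum (hip F.L x y + 0)) UNIV"
    unfolding * by (rule has_sum_add)
  then show ?thesis by (simp add: infsumI)
qed

lemma U_surj:
  assumes y: "y \<in> hcarrier F.L"
  shows "\<exists>x\<in>hcarrier F.L. U x = y"
proof -
  have yC: "y n \<in> C" for n using y by simp
  obtain m q where mq: "m \<in> M'" "q \<in> orth M'" "y 0 = hadd H m q"
    using projection[OF M' yC[of 0]] by metis
  obtain v where v: "v \<in> M" "V v = m" using V_surj mq by blast
  \<comment> \<open>The inverse of the block: the part of \<open>y 0\<close> in \<open>M'\<close> is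
    pulled back through \<open>V\<close> and joined with \<open>y 1\<close>, while the part
    orthogonal to \<open>M'\<close> returns to index -1.\<close>
  define x where "x n = (if n = 0 then hadd H v (y 1) else if n = -1 then q else y (n + 1))" for n
  have y1: "y 1 \<in> orth M" using LS[OF y, of 1] by simp
  have "(\<lambda>n. (hnorm H (x n))\<^sup>2) summable_on UNIV"
    by (rule summable_on_finite_change[OF shift_summable[OF y, of 1], of "{0, -1}"]) (auto simp: x_def)
  moreover have "x n \<in> S n" for n
  proof -
    consider "n = 0" | "n = -1" | "n > 0" | "n < -1" by linarith
    then show ?thesis
    proof cases
      case 3 then show ?thesis using LS[OF y, of "n + 1"] by (simp add: x_def)
    next
      case 4 then show ?thesis using LS[OF y, of "n + 1"] by (simp add: x_def)
    qed (use yC mq v MC in \<open>simp_all add: x_def\<close>)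
  qed
  ultimately have "x \<in> hcarrier F.L" by (simp add: F.L_carrier)
  moreover have "U x = y"
  proof
    fix n show "U x n = y n"
      using PQ_unique[OF v(1) y1] v mq by (auto simp: U_def x_def)
  qed
  ultimately show ?thesis by blast
qed

lemma U_eigen:
  assumes a: "a \<in> {1, -1}" and x: "x \<in> hcarrier F.L" and e: "U x = hsmul F.L a x"
  shows "x = hzero F.L"
proof -
  have xC: "x n \<in> C" for n using x by simp
  have sm: "(\<lambda>n. (hnorm H (x n))\<^sup>2) summable_on UNIV" using x by (simp add: F.L_carrier)
  have en: "U x n = hsmul H a (x n)" for n using e by simp
  \<comment> \<open>At the excluded indices \<open>U\<close> is not a shift. The remaining steps
    still link all positive indices to each other, and all negative ones.\<close>
  have step: "hnorm H (x (n - 1)) = hnorm H (x n)" if "n \<noteq> 0" "n \<noteq> 1" for n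
  proof -
    have "x (n - 1) = hsmul H a (x n)" using en[of n] that by (simp add: U_def)
    then show ?thesis using a xC by auto
  qed
  have pos: "x n = hzero H" if n: "n > 0" for n
  proof -
    have "hnorm H (x (n + int k)) = hnorm H (x n)" for k
    proof (induction k)
      case (Suc k)
      then show ?case using step[of "n + int (Suc k)"] n by (simp add: algebra_simps)
    qed simp
    then have "(hnorm H (x n))\<^sup>2 = 0"
      by (intro summable_on_constant_subsequence[OF sm, of "\<lambda>k. n + int k"]) (auto simp: inj_def)
    then show ?thesis using norm_eq_0D xC by simp
  qed
  have neg: "x n = hzero H" if n: "n < 0" for n
  proof -
    have "hnorm H (x (n - int k)) = hnorm H (x n)" for k
    proof (induction k)
      case (Suc k)
      then show ?case using step[of "n - int k"] n by (simp add: algebra_simps)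
    qed simp
    then have "(hnorm H (x n))\<^sup>2 = 0"
      by (intro summable_on_constant_subsequence[OF sm, of "\<lambda>k. n - int k"]) (auto simp: inj_def)
    then show ?thesis using norm_eq_0D xC by simp
  qed
  \<comment> \<open>With the tails gone, coordinate 1 of the eigenvalue equation puts
    \<open>x 0\<close> in \<open>M\<close>, and coordinate 0 makes it an eigenvector of
    \<open>V\<close>.\<close>
  have "Q (x 0) = hzero H" using en[of 1] pos[of 1] by (simp add: U_def smul_zero_right)
  then have "x 0 = P (x 0)" using PQ(3)[OF xC[of 0]] xC by (simp add: add_zero_right)
  then have "x 0 \<in> M" "P (x 0) = x 0" using PQ(1)[OF xC[of 0]] by simp_all
  moreover then have "V (x 0) = hsmul H a (x 0)"
    using en[of 0] neg[of "-1"] V_in[of "x 0"] MC by (simp add: U_def add_zero_right)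
  ultimately have "x 0 = hzero H" using V_eigen a by blast
  then have "x n = hzero H" for n using pos neg by (cases n "0::int" rule: linorder_cases) auto
  then show ?thesis by auto
qed

sublocale dil: unitary_no_fixed F.L U
proof unfold_locales
  fix x assume x: "x \<in> hcarrier F.L"
  show "U x \<in> hcarrier F.L" by (rule U_closed[OF x])
  show "U x = x \<Longrightarrow> x = hzero F.L" using U_eigen[of 1 x] x L.smul_one by (metis insertI1)
  show "U x = hsmul F.L (- 1) x \<Longrightarrow> x = hzero F.L" using U_eigen[of "-1" x] x by blast
qed (fact U_add U_smul U_ip U_surj)+

section \<open>The original space as the zeroth coordinate\<close>

definition J :: "'a \<Rightarrow> int \<Rightarrow> 'a" where
  "J h n = (if n = 0 then h else hzero H)"

lemma J_closed: "h \<in> C \<Longrightarrow> J h \<in> hcarrier F.L"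
proof -
  assume h: "h \<in> C"
  have "(\<lambda>n. (hnorm H (J h n))\<^sup>2) summable_on UNIV"
    by (rule summable_on_finite_change[of "\<lambda>_. 0" "{0}"]) (auto simp: J_def)
  moreover have "J h n \<in> S n" for n
    using h subspace_zero sub_orth by (simp add: J_def S_def)
  ultimately show ?thesis by (simp add: F.L_carrier)
qed

lemma J_add: "J (hadd H x y) = hadd F.L (J x) (J y)"
  by (auto simp: J_def add_zero_left)

lemma J_smul: "J (hsmul H a x) = hsmul F.L a (J x)"
  by (auto simp: J_def smul_zero_right)

lemma J_ip: "x \<in> C \<Longrightarrow> y \<in> C \<Longrightarrow> hip F.L (J x) (J y) = ip x y"
proof -
  assume "x \<in> C" "y \<in> C"
  have "((\<lambda>n. ip (J x n) (J y n)) has_sum ip x y) UNIV"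
    by (rule has_sum_finite_neutralI[of "{0}"]) (auto simp: J_def)
  then show ?thesis by (simp add: infsumI)
qed

text \<open>A vector of \<open>M\<close> has no component orthogonal to \<open>M\<close>, so nothing
  enters the right tail, and the left tail is empty.\<close>

lemma U_J:
  assumes "h \<in> M"
  shows "U (J h) = J (V h)"
proof
  fix n show "U (J h) n = J (V h) n"
    using PQ_M[OF assms] V_in[OF assms] MC by (simp add: U_def J_def add_zero_right)
qed

end

lemma (in unitary_no_fixed) unitary_transport:
  assumes inj: "inj_on e C"
  shows "unitary_no_fixed (transport e H) (\<lambda>x. e (U (inv_into C e x)))"
proof -
  note [simp] = transport_ops[OF inj] transport_carrier[OF inj] inv_into_f_f[OF inj]
  have eq: "e x = e y \<longleftrightarrow> x = y" if "x \<in> C" "y \<in> C" for x y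
    using inj that by (auto simp: inj_on_def)
  show ?thesis
  proof (unfold_locales, goal_cases)
    case 1 show ?case by (rule hilbert_space_transport[OF inj])
  next
    case 2 then show ?case by auto
  next
    case 3 then show ?case by (auto simp: U_add)
  next
    case 4 then show ?case by (auto simp: U_smul)
  next
    case 5 then show ?case by (auto simp: U_ip)
  next
    case (6 y)
    then obtain v where "v \<in> C" "y = e v" by auto
    moreover then obtain u where "u \<in> C" "U u = v" using U_surj by blast
    ultimately show ?case by auto
  next
    case (7 x)
    then obtain u where "u \<in> C" "x = e u" by auto
    then show ?case using 7 U_fixed[of u] by (simp add: eq)
  next
    case (8 x)
    then obtain u where "u \<in> C" "x = e u" by auto
    then show ?case using 8 U_antifixed[of u] by (simp add: eq)
  qed
qed

subsection \<open>Isometric embeddings and encodings\<close>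

text \<open>Closedness of the image is automatic: a convergent sequence in the image has Cauchy
  preimages, which converge because the source is complete.\<close>

lemma isometric_embeddingI:
  assumes H1: "hilbert_space H1" and H2: "hilbert_space H2"
    and J: "\<And>x. x \<in> hcarrier H1 \<Longrightarrow> J x \<in> hcarrier H2"
    and J_add: "\<And>x y. x \<in> hcarrier H1 \<Longrightarrow> y \<in> hcarrier H1 \<Longrightarrow> J (hadd H1 x y) = hadd H2 (J x) (J y)"
    and J_smul: "\<And>a x. x \<in> hcarrier H1 \<Longrightarrow> J (hsmul H1 a x) = hsmul H2 a (J x)"
    and J_ip: "\<And>x y. x \<in> hcarrier H1 \<Longrightarrow> y \<in> hcarrier H1 \<Longrightarrow> hip H2 (J x) (J y) = hip H1 x y"
  shows "isometric_embedding H1 H2 J"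
proof -
  interpret A: hilb H1 by unfold_locales (rule H1)
  interpret B: hilb H2 by unfold_locales (rule H2)
  have norm: "hnorm H2 (hsub H2 (J x) (J y)) = hnorm H1 (hsub H1 x y)" if "x \<in> A.C" "y \<in> A.C" for x y
    using that by (simp add: hnorm_def J J_ip)
  have "l \<in> J ` A.C" if s: "\<And>n. s n \<in> J ` A.C" and l: "l \<in> B.C" "hconverges H2 s l" for s l
  proof -
    obtain t where t: "\<And>n. t n \<in> A.C" "\<And>n. s n = J (t n)" using s unfolding image_iff by metis
    have sB: "s n \<in> B.C" for n using t J by simp
    have "hcauchy H2 s" using B.converges_cauchy[OF sB l] .
    then have "hcauchy H1 t" using t norm by (simp add: hcauchy_def)
    then obtain a where a: "a \<in> A.C" "hconverges H1 t a" using A.complete[of t] t(1) by blast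
    then have "hconverges H2 s (J a)" using t norm by (simp add: hconverges_def)
    then have "l = J a" using B.converges_unique[OF sB l(1) J[OF a(1)] l(2)] by blast
    then show ?thesis using a by blast
  qed
  then show ?thesis
    unfolding isometric_embedding_def hclosed_set_def using J J_add J_smul J_ip by blast
qed

text \<open>A vector is encoded by a chosen list of coefficients. The spanning list may be linearly
  dependent, but any choice is injective because the linear combination gives the vector
  back.\<close>

lemma finite_dim_coordinates:
  assumes "hfinite_dim H N"
  shows "\<exists>c :: 'a \<Rightarrow> nat \<Rightarrow> complex. inj_on c N"
proof -
  obtain fs where fs: "\<And>v. v \<in> N \<Longrightarrow> \<exists>cs. length cs = length fs \<and> v = hlincomb H cs fs"
    using assms unfolding hfinite_dim_def by blast
  then obtain k where k: "\<And>v. v \<in> N \<Longrightarrow> length (k v) = length fs \<and> v = hlincomb H (k v) fs"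
    by metis
  \<comment> \<open>All coefficient lists have the same length, so padding with zeros loses
    nothing.\<close>
  have "inj_on (\<lambda>v j. if j < length fs then k v ! j else 0) N"
  proof (rule inj_onI)
    fix u v assume uv: "u \<in> N" "v \<in> N"
      and e: "(\<lambda>j. if j < length fs then k u ! j else 0) = (\<lambda>j. if j < length fs then k v ! j else 0)"
    have "k u ! j = k v ! j" if "j < length fs" for j using fun_cong[OF e, of j] that by simp
    then have "k u = k v" using k uv by (intro nth_equalityI) auto
    then show "u = v" using k uv by metis
  qed
  then show ?thesis by blast
qed

lemma int_sequence_encoding:
  fixes c c' :: "'a \<Rightarrow> nat \<Rightarrow> complex"
  assumes c: "inj_on c N" and c': "inj_on c' N'"
  shows "\<exists>e :: (int \<Rightarrow> 'a) \<Rightarrow> 'a \<times> (nat \<Rightarrow> complex).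
    inj_on e {x. (\<forall>n>0. x n \<in> N) \<and> (\<forall>n<0. x n \<in> N')}"
proof -
  define g where "g x n = (if n > 0 then c (x n) else c' (x n))" for x :: "int \<Rightarrow> 'a" and n
  \<comment> \<open>A natural number codes a pair of an integer index and a coordinate index, which
    flattens both tails into one complex sequence.\<close>
  define e where "e x = (x 0, \<lambda>k. g x (int_decode (fst (prod_decode k))) (snd (prod_decode k)))" for x
  have "inj_on e {x. (\<forall>n>0. x n \<in> N) \<and> (\<forall>n<0. x n \<in> N')}"
  proof (rule inj_onI, elim CollectE conjE)
    fix x y :: "int \<Rightarrow> 'a" assume x: "\<forall>n>0. x n \<in> N" "\<forall>n<0. x n \<in> N'"
      and y: "\<forall>n>0. y n \<in> N" "\<forall>n<0. y n \<in> N'" and e: "e x = e y"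
    have g: "g x n = g y n" for n
    proof
      fix j
      have "snd (e x) (prod_encode (int_encode n, j)) = snd (e y) (prod_encode (int_encode n, j))"
        using e by simp
      then show "g x n j = g y n j" by (simp add: e_def)
    qed
    show "x = y"
    proof
      fix n :: int
      consider "n = 0" | "n > 0" | "n < 0" by linarith
      then show "x n = y n"
      proof cases
        case 1 then show ?thesis using e by (simp add: e_def)
      next
        case 2 then show ?thesis using g[of n] x y inj_onD[OF c] by (simp add: g_def)
      next
        case 3 then show ?thesis using g[of n] x y inj_onD[OF c'] by (simp add: g_def)
      qed
    qed
  qed
  then show ?thesis by blast
qed

subsection \<open>Cayley transform of a symmetric operator\<close>

locale closed_symmetric = hilb H for H :: "'a cspace" +
  fixes D :: "'a set" and T :: "'a \<Rightarrow> 'a"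
  assumes closed_op: "closed_operator H D T"
    and symm: "symmetric_operator H D T"
    and inj_T: "inj_on T D"
begin

lemma lin: "linear_operator H D T"
  using symm by (simp add: symmetric_operator_def)

lemma D_add: "x \<in> D \<Longrightarrow> y \<in> D \<Longrightarrow> hadd H x y \<in> D"
  and D_smul: "x \<in> D \<Longrightarrow> hsmul H a x \<in> D"
  and D_zero: "hzero H \<in> D"
  and D_C [simp]: "x \<in> D \<Longrightarrow> x \<in> C"
  and T_C [simp]: "x \<in> D \<Longrightarrow> T x \<in> C"
  and T_add: "x \<in> D \<Longrightarrow> y \<in> D \<Longrightarrow> T (hadd H x y) = hadd H (T x) (T y)"
  and T_smul: "x \<in> D \<Longrightarrow> T (hsmul H a x) = hsmul H a (T x)"
  using lin by (auto simp: linear_operator_def)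

lemma D_sub: "x \<in> D \<Longrightarrow> y \<in> D \<Longrightarrow> hsub H x y \<in> D"
  and T_sub: "x \<in> D \<Longrightarrow> y \<in> D \<Longrightarrow> T (hsub H x y) = hsub H (T x) (T y)"
  by (simp_all add: hsub_def D_add D_smul T_add T_smul)

lemma T_symm: "x \<in> D \<Longrightarrow> y \<in> D \<Longrightarrow> ip (T x) y = ip x (T y)"
  using symm by (auto simp: symmetric_operator_def)

section \<open>The ranges of \<open>T + \<i>\<close> and \<open>T - \<i>\<close>\<close>

definition "R w u = hadd H (T u) (hsmul H w u)"

lemma R_C [simp]: "u \<in> D \<Longrightarrow> R w u \<in> C"
  by (simp add: R_def)

lemma R_add: "u \<in> D \<Longrightarrow> v \<in> D \<Longrightarrow> R w (hadd H u v) = hadd H (R w u) (R w v)"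
  unfolding R_def by (rule vec_eqI) (simp_all add: D_add T_add algebra_simps)

lemma R_smul: "u \<in> D \<Longrightarrow> R w (hsmul H a u) = hsmul H a (R w u)"
  unfolding R_def by (rule vec_eqI) (simp_all add: D_smul T_smul algebra_simps)

lemma R_sub: "u \<in> D \<Longrightarrow> v \<in> D \<Longrightarrow> R w (hsub H u v) = hsub H (R w u) (R w v)"
  by (simp add: hsub_def R_add R_smul D_smul)

text \<open>The cross terms cancel by symmetry, since \<open>w\<close> is purely imaginary, and
  \<open>w\<close> has modulus 1. The value is the same for both signs, which makes the Cayley
  transform isometric.\<close>

lemma R_ip:
  assumes "w \<in> {\<i>, -\<i>}" "u \<in> D" "v \<in> D"
  shows "ip (R w u) (R w v) = ip (T u) (T v) + ip u v"
  using assms T_symm[of u v] by (auto simp: R_def algebra_simps)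

lemma R_norm_le:
  assumes "w \<in> {\<i>, -\<i>}" "u \<in> D"
  shows "hnorm H u \<le> hnorm H (R w u)" "hnorm H (T u) \<le> hnorm H (R w u)"
  unfolding hnorm_def R_ip[OF assms(1,2,2)] using assms by (simp_all add: ip_nonneg)

lemma R_subspace: "subspace (R w ` D)"
proof -
  have "hzero H = R w (hzero H)"
    using R_smul[OF D_zero, of w 0] smul_zero_left R_C[OF D_zero] by simp
  then have "hzero H \<in> R w ` D" using D_zero by blast
  moreover have "hadd H x y \<in> R w ` D" if "x \<in> R w ` D" "y \<in> R w ` D" for x y
    using that by (auto simp: R_add[symmetric] D_add)
  moreover have "hsmul H a x \<in> R w ` D" if "x \<in> R w ` D" for a x
    using that by (auto simp: R_smul[symmetric] D_smul)
  ultimately show ?thesis by (auto simp: subspace_def)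
qed

text \<open>The norm of \<open>R w u\<close> dominates those of \<open>u\<close> and
  \<open>T u\<close>, so a convergent sequence in the range lifts to a sequence that is Cauchy in
  the graph of \<open>T\<close>, and that graph is closed.\<close>

lemma R_closed:
  assumes w: "w \<in> {\<i>, -\<i>}"
  shows "hclosed_set H (R w ` D)"
  unfolding hclosed_set_def
proof (intro allI impI, elim conjE)
  fix s l assume "\<forall>n. s n \<in> R w ` D" and l: "l \<in> C" "hconverges H s l"
  then have "\<forall>n. \<exists>u. u \<in> D \<and> s n = R w u" by blast
  then obtain u where u: "\<And>n. u n \<in> D" "\<And>n. s n = R w (u n)" by metis
  have sC: "\<And>n. s n \<in> C" using u by simp
  have cau: "hcauchy H s" using converges_cauchy[OF sC l] .
  have cauchyI: "hcauchy H f" if "\<And>m n. hnorm H (hsub H (f m) (f n)) \<le> hnorm H (hsub H (s m) (s n))" for f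
    using cau that unfolding hcauchy_def by (meson le_less_trans)
  have "hcauchy H u" "hcauchy H (\<lambda>n. T (u n))"
    by (rule cauchyI, use R_norm_le[OF w D_sub] u in \<open>simp add: R_sub T_sub\<close>)+
  then obtain a b where a: "a \<in> C" "hconverges H u a" and b: "b \<in> C" "hconverges H (\<lambda>n. T (u n)) b"
    using complete[of u] complete[of "\<lambda>n. T (u n)"] u by auto
  then have aD: "a \<in> D" "T a = b"
    using closed_op[unfolded closed_operator_def] u(1) by blast+
  have "l = R w a"
  proof (rule vec_eqI)
    fix z assume z: "z \<in> C"
    have "(\<lambda>n. ip (T (u n)) z + w * ip (u n) z) \<longlonglongrightarrow> ip b z + w * ip a z"
      using a b u z by (intro tendsto_intros ip_tendsto) auto
    moreover have "(\<lambda>n. ip (T (u n)) z + w * ip (u n) z) \<longlonglongrightarrow> ip l z"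
      using ip_tendsto[OF sC l(1) z l(2)] u z by (simp add: R_def)
    ultimately have "ip l z = ip b z + w * ip a z" using LIMSEQ_unique by blast
    then show "ip l z = ip (R w a) z" using aD a z by (auto simp: R_def)
  qed (use aD l in simp_all)
  then show "l \<in> R w ` D" using aD by blast
qed

lemma R_inj:
  assumes w: "w \<in> {\<i>, -\<i>}"
  shows "inj_on (R w) D"
proof (rule inj_onI)
  fix u v assume uv: "u \<in> D" "v \<in> D" "R w u = R w v"
  have "R w (hsub H u v) = hsub H (R w v) (R w v)" using uv by (simp add: R_sub)
  then have "hnorm H (R w (hsub H u v)) = 0" using uv by (simp add: hnorm_def)
  then have "hnorm H (hsub H u v) = 0"
    using R_norm_le(1)[OF w D_sub[OF uv(1,2)]] norm_nonneg[OF D_C[OF D_sub[OF uv(1,2)]]] by linarith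
  then show "u = v" using norm_eq_0D[of "hsub H u v"] sub_eq_zeroD[of u v] uv by simp
qed

text \<open>Identifies the summands of the tails as defect spaces. The sign changes because the
  defect space at \<open>z\<close> belongs to \<open>T - z\<close>.\<close>

lemma orth_R: "orth (R w ` D) = defect_space H D T (- w)"
proof -
  have "hsub H (T x) (hsmul H (- w) x) = R w x" if "x \<in> D" for x
    unfolding R_def by (rule vec_eqI) (use that in simp_all)
  then show ?thesis unfolding orth_def defect_space_def by auto
qed

definition "V h = R (-\<i>) (inv_into D (R \<i>) h)"

lemma V_R: "u \<in> D \<Longrightarrow> V (R \<i> u) = R (-\<i>) u"
  by (simp add: V_def R_inj)

sublocale partial_isometry H "R \<i> ` D" "R (-\<i>) ` D" V
proof (unfold_locales, goal_cases)
  case (10 a x)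
  then obtain u where u: "u \<in> D" "x = R \<i> u" by blast
  then have e: "R (-\<i>) u = hsmul H a (R \<i> u)" using 10 V_R by simp
  \<comment> \<open>The eigenvalue equation for \<open>V\<close>, written in terms of
    \<open>u\<close>: the value 1 for \<open>a\<close> gives \<open>u = 0\<close> directly, and -1
    gives \<open>T u = 0\<close>, whence \<open>u = 0\<close> by injectivity of
    \<open>T\<close>.\<close>
  have ez: "ip (T u) z - \<i> * ip u z = a * (ip (T u) z + \<i> * ip u z)" if "z \<in> C" for z
  proof -
    have "ip (R (-\<i>) u) z = ip (hsmul H a (R \<i> u)) z" using e by simp
    then show ?thesis using u that by (simp add: R_def)
  qed
  have "u = hzero H"
  proof (cases "a = 1")
    case True
    show ?thesis by (rule vec_eqI) (use True ez u in \<open>auto simp: algebra_simps\<close>)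
  next
    case False
    then have a: "a = -1" using 10 by simp
    have "T u = hzero H" by (rule vec_eqI) (use a ez u in \<open>auto simp: algebra_simps\<close>)
    moreover have "T (hzero H) = hzero H"
      using T_smul[OF D_zero, of 0] smul_zero_left T_C[OF D_zero] by simp
    ultimately show ?thesis using inj_T u D_zero by (auto simp: inj_on_def)
  qed
  then show ?case using u R_smul[OF D_zero, of \<i> 0] smul_zero_left R_C[OF D_zero] by simp
next
  case (9 y) then show ?case using V_R by auto
next
  case (8 x y) then show ?case by (auto simp: V_R R_ip)
next
  case (7 x a) then show ?case by (auto simp: V_R R_smul[symmetric] D_smul)
next
  case (6 x y) then show ?case by (auto simp: V_R R_add[symmetric] D_add)
next
  case (5 x) then show ?case by (auto simp: V_R)
qed (use R_subspace R_closed in auto)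

text \<open>Exhibits \<open>J u\<close> in the domain of the inverse Cayley transform of
  \<open>U\<close>, with value \<open>J (T u)\<close>. The factor is explained by the difference and
  the sum of \<open>(T + \<i>)u\<close> and \<open>(T - \<i>)u\<close>, which are
  \<open>2\<i>u\<close> and \<open>2Tu\<close>.\<close>

lemma J_eq_K:
  assumes u: "u \<in> D"
  defines "y \<equiv> J (hsmul H (1 / (2 * \<i>)) (R \<i> u))"
  shows "y \<in> hcarrier F.L" "J u = hsub F.L y (U y)" "J (T u) = hsmul F.L \<i> (hadd F.L y (U y))"
proof -
  define h where "h = hsmul H (1 / (2 * \<i>)) (R \<i> u)"
  have hM: "h \<in> R \<i> ` D" using u subspace_smul[OF R_subspace] by (simp add: h_def)
  have hC: "h \<in> C" using u by (simp add: h_def)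
  have Vh: "V h = hsmul H (1 / (2 * \<i>)) (R (-\<i>) u)"
    using u V_smul[of "R \<i> u"] V_R by (simp add: h_def)
  have Uy: "U y = J (V h)" unfolding y_def using U_J[OF hM] by (simp add: h_def)
  show "y \<in> hcarrier F.L" unfolding y_def using J_closed[OF hC] by (simp add: h_def)
  have "u = hsub H h (V h)" unfolding Vh unfolding h_def
    by (rule vec_eqI) (use u in \<open>simp_all add: R_def field_simps\<close>)
  then have "J u = J (hsub H h (V h))" by simp
  also have "\<dots> = hsub F.L y (U y)" unfolding Uy
    by (simp only: y_def h_def[symmetric] hsub_def J_add J_smul)
  finally show "J u = hsub F.L y (U y)" .
  have "T u = hsmul H \<i> (hadd H h (V h))" unfolding Vh unfolding h_def
    by (rule vec_eqI) (use u in \<open>simp_all add: R_def field_simps\<close>)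
  then have "J (T u) = J (hsmul H \<i> (hadd H h (V h)))" by simp
  also have "\<dots> = hsmul F.L \<i> (hadd F.L y (U y))" unfolding Uy
    by (simp only: y_def h_def[symmetric] J_add J_smul)
  finally show "J (T u) = hsmul F.L \<i> (hadd F.L y (U y))" .
qed

end

theorem theorem2:
  fixes H :: "'a cspace" and D :: "'a set" and T :: "'a \<Rightarrow> 'a"
  assumes "hilbert_space H"
    and "closed_operator H D T"
    and "symmetric_operator H D T"
    and "inj_on T D"
    and "\<And>z. Im z \<noteq> 0 \<Longrightarrow> hfinite_dim H (defect_space H D T z)"
  shows "\<exists>(H' :: ('a \<times> (nat \<Rightarrow> complex)) cspace) J D' T'.
           hilbert_space H' \<and> isometric_embedding H H' J \<and>
           self_adjoint H' D' T' \<and> inj_on T' D' \<and>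
           (\<forall>x\<in>D. J x \<in> D' \<and> T' (J x) = J (T x))"
proof -
  interpret closed_symmetric H D T
    by unfold_locales (use assms in auto)
  \<comment> \<open>The tails are the defect spaces at \<open>-\<i>\<close> and \<open>\<i>\<close>,
    one in each half-plane.\<close>
  have fd: "hfinite_dim H (orth (R \<i> ` D))" "hfinite_dim H (orth (R (-\<i>) ` D))"
    unfolding orth_R by (rule assms(5); simp)+
  obtain c c' :: "'a \<Rightarrow> nat \<Rightarrow> complex"
    where "inj_on c (orth (R \<i> ` D))" "inj_on c' (orth (R (-\<i>) ` D))"
    using finite_dim_coordinates[OF fd(1)] finite_dim_coordinates[OF fd(2)] by blast
  then obtain e :: "(int \<Rightarrow> 'a) \<Rightarrow> 'a \<times> (nat \<Rightarrow> complex)"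
    where "inj_on e {x. (\<forall>n>0. x n \<in> orth (R \<i> ` D)) \<and> (\<forall>n<0. x n \<in> orth (R (-\<i>) ` D))}"
    using int_sequence_encoding by blast
  then have inj: "inj_on e (hcarrier F.L)"
    by (rule inj_on_subset) (use LS S_simps in \<open>auto, metis+\<close>)
  define H' where "H' = transport e F.L"
  define U' where "U' x = e (U (inv_into (hcarrier F.L) e x))" for x
  interpret W: unitary_no_fixed H' U'
    unfolding H'_def U'_def[abs_def] by (rule dil.unitary_transport[OF inj])
  note ops = L.transport_ops[OF inj, folded H'_def] L.transport_carrier[OF inj, folded H'_def]
  have emb: "isometric_embedding H H' (e \<circ> J)"
    by (rule isometric_embeddingI[OF hilbert W.hilbert])
      (simp_all add: ops J_closed J_add J_smul J_ip del: F.L_ops)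
  have ext: "(e \<circ> J) x \<in> W.dom_cayley \<and> W.cayley ((e \<circ> J) x) = (e \<circ> J) (T x)" if x: "x \<in> D" for x
  proof -
    \<comment> \<open>The preimage of \<open>J x\<close> under \<open>1 - U\<close>; its copy under
      \<open>e\<close> shows that the transported self-adjoint operator extends
      \<open>T\<close>.\<close>
    define y where "y = J (hsmul H (1 / (2 * \<i>)) (R \<i> x))"
    note y = J_eq_K[OF x, folded y_def]
    have eyW: "e y \<in> W.C" using y(1) by (simp add: ops)
    have Uy: "U y \<in> hcarrier F.L" "U' (e y) = e (U y)"
      using y(1) U_closed inj by (simp_all add: U'_def)
    have "(e \<circ> J) x = W.K (e y)"
      unfolding W.K_def using y Uy by (simp add: ops del: F.L_ops)
    moreover have "W.cayley (W.K (e y)) = (e \<circ> J) (T x)"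
      unfolding W.cayley_K[OF eyW] using y Uy by (simp add: ops del: F.L_ops)
    ultimately show ?thesis using eyW by (auto simp: W.dom_cayley_def)
  qed
  show ?thesis
    using W.hilbert emb W.self_adjoint_cayley W.inj_cayley ext by blast
qed

end
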